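(* Let $\Omega\subset\mathbb{R}^N$ be a smooth bounded domain with $C^{1,1}$ boundary, $s\in(0,1)$, $p\in(1,\infty)$, $\gamma>0$, $\delta\in(0,sp)$ with $0<\delta<1+s-\frac1p$, and let $K_\delta$ satisfy $\mathcal{C}_1 d(x)^{-\delta}\le K_\delta(x)\le \mathcal{C}_2 d(x)^{-\delta}$ for all $x\in\Omega$, for some constants $\mathcal{C}_1,\mathcal{C}_2>0$. Then the minimal weak solution $u$ of $(P)$ is the unique weak solution of $(P)$.
   Context: Here $d(x)=\operatorname{dist}(x,\partial\Omega)$ and $[t]^{p-1}:=|t|^{p-2}t$ for $t\in\mathbb{R}$. Problem $(P)$ is: $(-\Delta)^s_p u=\frac{K_\delta(x)}{u^\gamma}$, $u>0$ in $\Omega$, $u=0$ in $\mathbb{R}^N\setminus\Omega$, where $(-\Delta)^s_p u(x)=2\lim_{\epsilon\to0}\int_{\mathbb{R}^N\setminus B_\epsilon(x)}\frac{[u(x)-u(y)]^{p-1}}{|x-y|^{N+sp}}\,dy$. Function spaces: $W^{s,p}(\mathbb{R}^N)=\{u\in L^p(\mathbb{R}^N): [u]_{s,p}<\infty\}$ with $[u]_{s,p}^p=\iint_{\mathbb{R}^{2N}}\frac{|u(x)-u(y)|^p}{|x-y|^{N+sp}}dx\,dy$. For an open set $\omega$, $W^{s,p}_0(\omega)=\{u\in W^{s,p}(\mathbb{R}^N): u=0\text{ a.e. in }\mathbb{R}^N\setminus\omega\}$. $W^{s,p}_{loc}(\Omega)$ is the set of $u:\Omega\to\mathbb{R}$ with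 $u\in L^p(\omega)$ and $\iint_{\omega\times\omega}\frac{|u(x)-u(y)|^p}{|x-y|^{N+sp}}dx\,dy<\infty$ for all $\omega\Subset\Omega$. Put $\mathbb{T}=\bigcup_{\tilde\Omega\Subset\Omega}W^{s,p}_0(\tilde\Omega)$. Weak solution of $(P)$: a function $u\in W^{s,p}_{loc}(\Omega)$, extended by $0$ outside $\Omega$, such that $u^\kappa\in W^{s,p}_0(\Omega)$ for some $\kappa\ge1$, $\inf_K u>0$ for all $K\Subset\Omega$, and $$\iint_{\mathbb{R}^{2N}}\frac{[u(x)-u(y)]^{p-1}(\phi(x)-\phi(y))}{|x-y|^{N+sp}}dx\,dy=\int_\Omega\frac{K_\delta(x)}{u^\gamma}\phi\,dx\quad\text{for all }\phi\in\mathbb{T}.$$ A weak solution $u$ is minimal if $u\le v$ a.e. in $\Omega$ for every weak solution $v$ of $(P)$ (a minimal weak solution exists for every $\delta\in(0,sp)$). *)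

theory Defs
  imports "HOL-Analysis.Analysis"
begin

section \<open>Domains with \<open>C\<^sup>1\<^sup>,\<^sup>1\<close> boundary\<close>

text \<open>A real function \<open>g\<close> of class \<open>C\<^sup>1\<^sup>,\<^sup>1\<close> on the subspace \<open>H\<close>:
  differentiable along \<open>H\<close>, with Lipschitz gradient \<open>G\<close>.\<close>

definition C11_on :: "'a::euclidean_space set \<Rightarrow> ('a \<Rightarrow> real) \<Rightarrow> bool" where
  "C11_on H g \<longleftrightarrow>
    (\<exists>G L. L-lipschitz_on H G \<and>
       (\<forall>y\<in>H. (g has_derivative (\<lambda>h. G y \<bullet> h)) (at y within H)))"

text \<open>Near each boundary point, \<open>\<Omega>\<close> is the part of a ball lying above the graph of a
  \<open>C\<^sup>1\<^sup>,\<^sup>1\<close> function. The unit vector \<open>e\<close> is the vertical direction of the local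
  orthonormal coordinate system; the remaining \<open>N - 1\<close> coordinates of \<open>x\<close> are represented
  by the orthogonal projection of \<open>x\<close> to the hyperplane orthogonal to \<open>e\<close>.\<close>

definition C11_boundary :: "'a::euclidean_space set \<Rightarrow> bool" where
  "C11_boundary \<Omega> \<longleftrightarrow>
    (\<forall>x0\<in>frontier \<Omega>. \<exists>r e g. 0 < r \<and> norm e = 1 \<and> C11_on {y. y \<bullet> e = 0} g \<and>
       \<Omega> \<inter> ball x0 r = {x \<in> ball x0 r. g (x - (x \<bullet> e) *\<^sub>R e) < x \<bullet> e})"

definition compactly_contained :: "'a::euclidean_space set \<Rightarrow> 'a set \<Rightarrow> bool"
    (infix "\<Subset>" 50) where
  "\<omega> \<Subset> \<Omega> \<longleftrightarrow> compact (closure \<omega>) \<and> closure \<omega> \<subseteq> \<Omega>"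


section \<open>Fractional Sobolev spaces\<close>

definition Lp_on :: "real \<Rightarrow> 'a::euclidean_space set \<Rightarrow> ('a \<Rightarrow> real) set" where
  "Lp_on p \<omega> = {u. set_borel_measurable lebesgue \<omega> u \<and>
                   set_integrable lebesgue \<omega> (\<lambda>x. \<bar>u x\<bar> powr p)}"

text \<open>The \<open>p\<close>-th power of the Gagliardo seminorm over \<open>\<omega> \<times> \<omega>\<close>. The integrand is
  \<open>0\<close> on the (null) diagonal, by the convention \<open>0 / 0 = 0\<close>.\<close>

definition gagliardo :: "real \<Rightarrow> real \<Rightarrow> 'a::euclidean_space set \<Rightarrow> ('a \<Rightarrow> real) \<Rightarrow> ennreal" where
  "gagliardo s p \<omega> u =
    (\<integral>\<^sup>+ (x, y) \<in> \<omega> \<times> \<omega>.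
        ennreal (\<bar>u x - u y\<bar> powr p / norm (x - y) powr (real DIM('a) + s * p))
      \<partial>(lebesgue \<Otimes>\<^sub>M lebesgue))"

definition Wsp :: "real \<Rightarrow> real \<Rightarrow> ('a::euclidean_space \<Rightarrow> real) set" where
  "Wsp s p = {u \<in> Lp_on p UNIV. gagliardo s p UNIV u < \<infinity>}"

definition Wsp0 :: "real \<Rightarrow> real \<Rightarrow> 'a::euclidean_space set \<Rightarrow> ('a \<Rightarrow> real) set" where
  "Wsp0 s p \<omega> = {u \<in> Wsp s p. AE x in lebesgue. x \<notin> \<omega> \<longrightarrow> u x = 0}"

definition Wsp_loc :: "real \<Rightarrow> real \<Rightarrow> 'a::euclidean_space set \<Rightarrow> ('a \<Rightarrow> real) set" where
  "Wsp_loc s p \<Omega> =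
    {u. \<forall>\<omega>. open \<omega> \<and> \<omega> \<Subset> \<Omega> \<longrightarrow> u \<in> Lp_on p \<omega> \<and> gagliardo s p \<omega> u < \<infinity>}"

definition test_functions :: "real \<Rightarrow> real \<Rightarrow> 'a::euclidean_space set \<Rightarrow> ('a \<Rightarrow> real) set" where
  "test_functions s p \<Omega> = (\<Union>\<omega> \<in> {\<omega>. open \<omega> \<and> \<omega> \<Subset> \<Omega>}. Wsp0 s p \<omega>)"


section \<open>Weak solutions\<close>

definition signed_pow :: "real \<Rightarrow> real \<Rightarrow> real" where
  "signed_pow p t = \<bar>t\<bar> powr (p - 2) * t"

definition weak_integrand ::
    "real \<Rightarrow> real \<Rightarrow> ('a::euclidean_space \<Rightarrow> real) \<Rightarrow> ('a \<Rightarrow> real) \<Rightarrow> 'a \<times> 'a \<Rightarrow> real" where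
  "weak_integrand s p u \<phi> = (\<lambda>(x, y).
     signed_pow p (u x - u y) * (\<phi> x - \<phi> y) / norm (x - y) powr (real DIM('a) + s * p))"

text \<open>Functions on \<open>\<Omega>\<close> are represented by total functions vanishing identically outside
  \<open>\<Omega>\<close>; inside \<open>\<Omega>\<close> they matter only up to null sets, so the infimum over \<open>K\<close> is the
  essential one. The two integrability conditions say that both sides of the
  weak formulation are meaningful, since Bochner integrals of non-integrable functions are \<open>0\<close>.
  For measurable \<open>k\<close> bounded on compact subsets of \<open>\<Omega>\<close> they follow from the other
  conditions if \<open>\<Omega>\<close> is bounded.\<close>

definition weak_solution ::
    "real \<Rightarrow> real \<Rightarrow> 'a::euclidean_space set \<Rightarrow> real \<Rightarrow> ('a \<Rightarrow> real) \<Rightarrow> ('a \<Rightarrow> real) \<Rightarrow> bool" where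
  "weak_solution s p \<Omega> \<gamma> k u \<longleftrightarrow>
     u \<in> Wsp_loc s p \<Omega> \<and>
     (\<forall>x. x \<notin> \<Omega> \<longrightarrow> u x = 0) \<and>
     (\<exists>\<kappa>\<ge>1. (\<lambda>x. u x powr \<kappa>) \<in> Wsp0 s p \<Omega>) \<and>
     (\<forall>K. K \<Subset> \<Omega> \<longrightarrow> (\<exists>c>0. AE x in lebesgue. x \<in> K \<longrightarrow> c \<le> u x)) \<and>
     (\<forall>\<phi> \<in> test_functions s p \<Omega>.
        integrable (lebesgue \<Otimes>\<^sub>M lebesgue) (weak_integrand s p u \<phi>) \<and>
        set_integrable lebesgue \<Omega> (\<lambda>x. k x / u x powr \<gamma> * \<phi> x) \<and>
        (LINT z|(lebesgue \<Otimes>\<^sub>M lebesgue). weak_integrand s p u \<phi> z) =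
        (LINT x:\<Omega>|lebesgue. k x / u x powr \<gamma> * \<phi> x))"

definition minimal_weak_solution ::
    "real \<Rightarrow> real \<Rightarrow> 'a::euclidean_space set \<Rightarrow> real \<Rightarrow> ('a \<Rightarrow> real) \<Rightarrow> ('a \<Rightarrow> real) \<Rightarrow> bool" where
  "minimal_weak_solution s p \<Omega> \<gamma> k u \<longleftrightarrow>
     weak_solution s p \<Omega> \<gamma> k u \<and>
     (\<forall>v. weak_solution s p \<Omega> \<gamma> k v \<longrightarrow> (AE x in lebesgue. x \<in> \<Omega> \<longrightarrow> u x \<le> v x))"

end

theory Submission
  imports Defs
begin

text \<open>Any two weak solutions \<open>u\<close> and \<open>v\<close> satisfy \<open>v \<le> u\<close>. The formal reason is that testing the
  difference of the two equations with \<open>(v - u)\<^sup>+\<close> gives a nonnegative left-hand side and a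
  nonpositive right-hand side, but this function is not an admissible test function. So let
  \<open>z = (v - \<epsilon>)\<^sup>+\<close>, which has finite energy, let \<open>w\<^sub>n = \<eta>\<^sub>n z\<close> with cut-offs \<open>\<eta>\<^sub>n\<close> of the distance to the
  complement of \<open>\<Omega>\<close>, and test with \<open>(w\<^sub>n - u)\<^sup>+\<close>. Pointwise, monotonicity of \<open>t \<mapsto> |t|\<^sup>p\<^sup>-\<^sup>2 t\<close>
  holds up to an error controlled by \<open>z\<close> and \<open>w\<^sub>n\<close> alone, so that no energy bound on \<open>u\<close> is needed.
  Outside \<open>\<Omega>\<close> there are balls comparable with the distance to the boundary, which yields a
  fractional Hardy inequality; by it \<open>w\<^sub>n\<close> converges to \<open>z\<close> in energy and the error vanishes in the
  limit.\<close>

section \<open>Pointwise inequalities\<close>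

text \<open>Testing with (v - u)^+ is not allowed for two reasons: its support may reach the
  boundary, and the solutions need not have finite energy, as only some power of each is known to.
  Subtracting \<epsilon> removes the range in which v fails to be a Lipschitz function of that
  power. The cut-off gives compact support but costs energy near the boundary; the Hardy inequality
  pays for it. The cut-off also breaks the monotonicity argument: the flux of v is comparable with
  that of z, the flux of u with that of w_n. The mismatch of the fluxes of z and w_n is measured in
  L^(p/(p-1)), where it tends to 0, and Young's inequality moves the increment of the test function
  into the coercive term. What remains is \<eta> |w_n(x) - w_n(y)|^p, whose integral is bounded in n
  but need not tend to 0. This dictates the order of limits: n to infinity for fixed \<eta>, then
  \<eta> to 0, and \<epsilon> to 0 last. The right-hand sides need no convergence at all: the
  integrands are nonnegative and increase with n, so a fixed one stays below all later ones.\<close>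

lemma signed_pow_eq: "signed_pow p t = sgn t * \<bar>t\<bar> powr (p - 1)"
proof (cases "t = 0")
  case False
  have "\<bar>t\<bar> powr (p - 1) = \<bar>t\<bar> powr (p - 2) * \<bar>t\<bar>"
    using False powr_add[of "\<bar>t\<bar>" "p - 2" 1] by simp
  moreover have "t = sgn t * \<bar>t\<bar>"
    by (simp add: sgn_mult_abs)
  ultimately show ?thesis
    by (simp add: signed_pow_def ac_simps)
qed (simp add: signed_pow_def)

lemma signed_pow_nonneg: "0 \<le> t \<Longrightarrow> signed_pow p t = t powr (p - 1)"
  by (cases "t = 0") (simp_all add: signed_pow_eq)

lemma signed_pow_minus: "signed_pow p (- t) = - signed_pow p t"
  by (simp add: signed_pow_def)

lemma abs_signed_pow: "\<bar>signed_pow p t\<bar> = \<bar>t\<bar> powr (p - 1)"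
  by (simp add: signed_pow_eq abs_mult sgn_if)

lemma signed_pow_mono:
  assumes "1 < p" "a \<le> b"
  shows "signed_pow p a \<le> signed_pow p b"
proof -
  have nn: "signed_pow p a \<le> signed_pow p b" if "0 \<le> a" "a \<le> b" for a b
    using that assms(1) by (simp add: signed_pow_nonneg powr_mono2)
  show ?thesis
  proof (cases "0 \<le> a \<or> b \<le> 0")
    case True
    then show ?thesis
      using nn[of a b] nn[of "- b" "- a"] assms(2) by (auto simp: signed_pow_minus)
  next
    case False
    then have "signed_pow p a \<le> 0" "0 \<le> signed_pow p b"
      by (auto simp: signed_pow_eq sgn_if)
    then show ?thesis by simp
  qed
qed

text \<open>For p < 2 the factor |t|^(p-2) is unbounded near 0, so the origin is treated through the
  modulus |t|^(p-1), which tends to 0 because 1 < p.\<close>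

lemma isCont_signed_pow:
  assumes "1 < p"
  shows "isCont (signed_pow p) t"
proof (cases "t = 0")
  case True
  have "((\<lambda>x. \<bar>x\<bar> powr (p - 1)) \<longlongrightarrow> \<bar>0\<bar> powr (p - 1)) (at (0::real))"
    by (rule tendsto_powr' [OF tendsto_rabs [OF tendsto_ident_at] tendsto_const]) (use assms in auto)
  then have "((\<lambda>x. \<bar>signed_pow p x\<bar>) \<longlongrightarrow> 0) (at 0)"
    by (simp add: abs_signed_pow)
  then have "(signed_pow p \<longlongrightarrow> 0) (at 0)"
    by (rule tendsto_rabs_zero_cancel)
  then show ?thesis
    by (simp add: isCont_def True signed_pow_eq)
next
  case False
  then show ?thesis
    unfolding signed_pow_def [abs_def] by (intro continuous_intros) auto
qed

lemma borel_measurable_signed_pow [measurable]: "signed_pow p \<in> borel_measurable borel"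
  unfolding signed_pow_def [abs_def] by measurable

lemma powr_add_le:
  fixes a b p :: real
  assumes "0 \<le> a" "0 \<le> b" "0 \<le> p"
  shows "(a + b) powr p \<le> 2 powr p * (a powr p + b powr p)"
proof -
  have "(a + b) powr p \<le> (2 * max a b) powr p"
    using assms by (intro powr_mono2) auto
  also have "\<dots> = 2 powr p * max a b powr p"
    using assms by (simp add: powr_mult)
  also have "\<dots> \<le> 2 powr p * (a powr p + b powr p)"
    by (intro mult_left_mono) (auto simp: max_def)
  finally show ?thesis .
qed

lemma powr_diff_le:
  fixes a b p :: real
  assumes "0 \<le> p"
  shows "\<bar>a - b\<bar> powr p \<le> 2 powr p * (\<bar>a\<bar> powr p + \<bar>b\<bar> powr p)"
proof -
  have "\<bar>a - b\<bar> powr p \<le> (\<bar>a\<bar> + \<bar>b\<bar>) powr p"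
    using assms by (intro powr_mono2) auto
  then show ?thesis
    using powr_add_le[of "\<bar>a\<bar>" "\<bar>b\<bar>" p] assms by simp
qed

text \<open>For \<open>p < 2\<close> the \<open>p\<close>-Laplacian is not strongly monotone; this is the substitute, whose
  error involves only one of the two functions.\<close>

lemma signed_pow_coercive:
  fixes p :: real
  assumes "1 < p"
  obtains c0 where "0 < c0"
    "\<And>a c. 0 \<le> c \<Longrightarrow>
       c0 * c powr p - c0 * 4 powr p * \<bar>a\<bar> powr p \<le> (signed_pow p a - signed_pow p (a - c)) * c"
proof
  \<comment> \<open>If 4|a| \<le> c, then a lies above -c/4 and a - c below -3c/4; by oddness the
    two values of \<open>signed_pow\<close> differ by at least \<open>c0\<close> times
    c^(p-1).\<close>
  define c0 where "c0 = (3/4) powr (p - 1) - (1/4) powr (p - 1)"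
  show c0: "0 < c0"
    using assms by (simp add: c0_def powr_less_mono2)
  fix a c :: real
  assume c: "0 \<le> c"
  have pw: "c powr (p - 1) * c = c powr p"
    using c powr_add[of c "p - 1" 1] by (cases "c = 0") simp_all
  show "c0 * c powr p - c0 * 4 powr p * \<bar>a\<bar> powr p \<le> (signed_pow p a - signed_pow p (a - c)) * c"
  proof (cases "4 * \<bar>a\<bar> \<le> c")
    case True
    have "signed_pow p (- (c/4)) \<le> signed_pow p a"
      by (rule signed_pow_mono) (use assms True in auto)
    moreover have "signed_pow p (a - c) \<le> signed_pow p (- (3/4 * c))"
      by (rule signed_pow_mono) (use assms True in auto)
    moreover have "signed_pow p (c/4) = (1/4) powr (p - 1) * c powr (p - 1)"
      using c by (simp add: signed_pow_nonneg flip: powr_mult)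
    moreover have "signed_pow p (3/4 * c) = (3/4) powr (p - 1) * c powr (p - 1)"
      using c by (simp add: signed_pow_nonneg flip: powr_mult)
    ultimately have "c0 * c powr (p - 1) \<le> signed_pow p a - signed_pow p (a - c)"
      by (simp add: c0_def signed_pow_minus left_diff_distrib)
    then have "c0 * c powr (p - 1) * c \<le> (signed_pow p a - signed_pow p (a - c)) * c"
      using c by (rule mult_right_mono)
    moreover have "0 \<le> c0 * 4 powr p * \<bar>a\<bar> powr p"
      using c0 by simp
    ultimately show ?thesis
      using pw by (simp add: mult.assoc)
  next
    case False
    \<comment> \<open>Now c < 4|a|, so the claimed lower bound is nonpositive and plain monotonicity
      is enough.\<close>
    have "c powr p \<le> (4 * \<bar>a\<bar>) powr p"
      using c False assms by (intro powr_mono2) auto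
    then have "c0 * c powr p \<le> c0 * 4 powr p * \<bar>a\<bar> powr p"
      using c0 by (simp add: powr_mult)
    moreover have "signed_pow p (a - c) \<le> signed_pow p a"
      by (rule signed_pow_mono) (use assms c in auto)
    then have "0 \<le> (signed_pow p a - signed_pow p (a - c)) * c"
      using c by simp
    ultimately show ?thesis by simp
  qed
qed

text \<open>A weighted Young inequality without optimal constants. Either X is at most \<mu> c^(p-1)
  and the first term suffices, or c is at most (X/\<mu>)^(1/(p-1)) and the second does.\<close>

lemma young_powr:
  fixes p \<mu> X c :: real
  assumes "1 < p" "0 < \<mu>" "0 \<le> X" "0 \<le> c"
  shows "X * c \<le> \<mu> * c powr p + \<mu> powr (- (1 / (p - 1))) * X powr (p / (p - 1))"
proof (cases "X \<le> \<mu> * c powr (p - 1)")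
  case True
  have "X * c \<le> \<mu> * c powr (p - 1) * c"
    using True assms by (intro mult_right_mono)
  also have "\<dots> = \<mu> * c powr p"
    using assms powr_add[of c "p - 1" 1] by (cases "c = 0") simp_all
  finally show ?thesis
    by (smt (verit) mult_nonneg_nonneg powr_ge_zero)
next
  case False
  then have X: "0 < X"
    using assms by (smt (verit) mult_nonneg_nonneg powr_ge_zero)
  have "c powr (p - 1) \<le> X / \<mu>"
    using False assms by (simp add: field_simps)
  then have "(c powr (p - 1)) powr (1 / (p - 1)) \<le> (X / \<mu>) powr (1 / (p - 1))"
    using assms by (intro powr_mono2) auto
  then have "c \<le> (X / \<mu>) powr (1 / (p - 1))"
    using assms by (simp add: powr_powr)
  then have "X * c \<le> X * (X / \<mu>) powr (1 / (p - 1))"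
    using assms by (intro mult_left_mono) auto
  also have "\<dots> = \<mu> powr (- (1 / (p - 1))) * (X powr 1 * X powr (1 / (p - 1)))"
    using X assms by (simp add: powr_divide powr_minus field_simps)
  also have "X powr 1 * X powr (1 / (p - 1)) = X powr (p / (p - 1))"
    using assms by (subst powr_add[symmetric]) (simp add: field_simps)
  finally show ?thesis
    using assms by (smt (verit) mult_nonneg_nonneg powr_ge_zero)
qed

text \<open>The two points carry the values of \<open>v\<close>, of \<open>z = (v - \<epsilon>)\<^sup>+\<close>, of a cut-off \<open>w \<le> z\<close>
  and of \<open>u\<close>; the test function is \<open>(w - u)\<^sup>+\<close>.\<close>

lemma pointwise_monotonicity:
  fixes p \<eta> :: real
  assumes p: "1 < p" and \<eta>: "0 < \<eta>"
  obtains C where "0 \<le> C"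
    "\<And>\<epsilon> vx vy wx wy ux uy zx zy \<phi>x \<phi>y.
       \<lbrakk>zx = max 0 (vx - \<epsilon>); zy = max 0 (vy - \<epsilon>); 0 \<le> wx; wx \<le> zx; 0 \<le> wy; wy \<le> zy;
        0 \<le> ux; 0 \<le> uy; \<phi>x = max 0 (wx - ux); \<phi>y = max 0 (wy - uy)\<rbrakk> \<Longrightarrow>
       (signed_pow p (ux - uy) - signed_pow p (vx - vy)) * (\<phi>x - \<phi>y)
         \<le> C * \<bar>signed_pow p (zx - zy) - signed_pow p (wx - wy)\<bar> powr (p / (p - 1))
            + \<eta> * \<bar>wx - wy\<bar> powr p"
proof -
  obtain c0 where c0: "0 < c0"
    "\<And>a c. 0 \<le> c \<Longrightarrow>
       c0 * c powr p - c0 * 4 powr p * \<bar>a\<bar> powr p \<le> (signed_pow p a - signed_pow p (a - c)) * c"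
    using signed_pow_coercive[OF p] by blast
  \<comment> \<open>Only a fraction \<theta> of the monotone difference is spent on coercivity, so
    that its error stays below \<eta> |a|^p. The gain is then \<mu> c^p, and \<mu> is also the
    weight in Young's inequality, so that the two terms cancel.\<close>
  define \<theta> where "\<theta> = min 1 (\<eta> / (c0 * 4 powr p))"
  define \<mu> where "\<mu> = \<theta> * c0"
  define C where "C = \<mu> powr (- (1 / (p - 1)))"
  have \<theta>: "0 < \<theta>" "\<theta> \<le> 1" "\<theta> * (c0 * 4 powr p) \<le> \<eta>"
    using c0(1) \<eta> by (auto simp: \<theta>_def min_def field_simps)
  have \<mu>: "0 < \<mu>" using \<theta> c0 by (simp add: \<mu>_def)
  have main: "(signed_pow p (ux - uy) - signed_pow p (vx - vy)) * (\<phi>x - \<phi>y)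
         \<le> C * \<bar>signed_pow p (zx - zy) - signed_pow p (wx - wy)\<bar> powr (p / (p - 1))
            + \<eta> * \<bar>wx - wy\<bar> powr p"
    if h: "zx = max 0 (vx - \<epsilon>)" "zy = max 0 (vy - \<epsilon>)" "0 \<le> wx" "wx \<le> zx" "0 \<le> wy" "wy \<le> zy"
      "0 \<le> ux" "0 \<le> uy" "\<phi>x = max 0 (wx - ux)" "\<phi>y = max 0 (wy - uy)" "\<phi>y < \<phi>x"
    for \<epsilon> vx vy wx wy ux uy zx zy \<phi>x \<phi>y
  proof -
    let ?c = "\<phi>x - \<phi>y" and ?a = "wx - wy"
    let ?Z = "signed_pow p (zx - zy)" and ?W = "signed_pow p (wx - wy)"
    have c: "0 \<le> ?c" using h by simp
    \<comment> \<open>Since \<phi>x > 0, also zx > 0, so the truncation is inactive at x, while at y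
      it can only increase the value.\<close>
    have "zx - zy \<le> vx - vy" using h by linarith
    then have 1: "?Z * ?c \<le> signed_pow p (vx - vy) * ?c"
      using c p by (intro mult_right_mono signed_pow_mono) auto
    \<comment> \<open>Here \<phi>x = wx - ux exactly, while \<phi>y is at least wy - uy.\<close>
    have "ux - uy \<le> ?a - ?c" using h by linarith
    then have 2: "signed_pow p (ux - uy) * ?c \<le> signed_pow p (?a - ?c) * ?c"
      using c p by (intro mult_right_mono signed_pow_mono) auto
    have "0 \<le> (?W - signed_pow p (?a - ?c)) * ?c"
      using signed_pow_mono[OF p, of "?a - ?c" ?a] c by simp
    then have "\<theta> * ((?W - signed_pow p (?a - ?c)) * ?c) \<le> (?W - signed_pow p (?a - ?c)) * ?c"
      using \<theta> by (intro mult_left_le_one_le) auto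
    moreover have "\<theta> * (c0 * ?c powr p - c0 * 4 powr p * \<bar>?a\<bar> powr p)
        \<le> \<theta> * ((?W - signed_pow p (?a - ?c)) * ?c)"
      using c0(2)[OF c] \<theta> by (intro mult_left_mono) auto
    moreover have "\<theta> * (c0 * ?c powr p - c0 * 4 powr p * \<bar>?a\<bar> powr p)
        = \<mu> * ?c powr p - \<theta> * (c0 * 4 powr p) * \<bar>?a\<bar> powr p"
      by (simp add: \<mu>_def algebra_simps)
    moreover have "\<theta> * (c0 * 4 powr p) * \<bar>?a\<bar> powr p \<le> \<eta> * \<bar>?a\<bar> powr p"
      using \<theta> by (intro mult_right_mono) auto
    ultimately have 3: "\<mu> * ?c powr p - \<eta> * \<bar>?a\<bar> powr p \<le> (?W - signed_pow p (?a - ?c)) * ?c"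
      by linarith
    have "(?W - ?Z) * ?c \<le> \<bar>?Z - ?W\<bar> * ?c"
      using c by (intro mult_right_mono) auto
    also have "\<dots> \<le> \<mu> * ?c powr p + C * \<bar>?Z - ?W\<bar> powr (p / (p - 1))"
      unfolding C_def by (rule young_powr) (use p \<mu> c in auto)
    finally have 4: "(?W - ?Z) * ?c \<le> \<mu> * ?c powr p + C * \<bar>?Z - ?W\<bar> powr (p / (p - 1))" .
    show ?thesis
      using 1 2 3 4 by (simp add: left_diff_distrib)
  qed
  show ?thesis
  proof
    show "0 \<le> C" by (simp add: C_def)
    fix \<epsilon> vx vy wx wy ux uy zx zy \<phi>x \<phi>y :: real
    assume h: "zx = max 0 (vx - \<epsilon>)" "zy = max 0 (vy - \<epsilon>)" "0 \<le> wx" "wx \<le> zx" "0 \<le> wy" "wy \<le> zy"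
      "0 \<le> ux" "0 \<le> uy" "\<phi>x = max 0 (wx - ux)" "\<phi>y = max 0 (wy - uy)"
    consider "\<phi>y < \<phi>x" | "\<phi>x < \<phi>y" | "\<phi>x = \<phi>y" by linarith
    then show "(signed_pow p (ux - uy) - signed_pow p (vx - vy)) * (\<phi>x - \<phi>y)
         \<le> C * \<bar>signed_pow p (zx - zy) - signed_pow p (wx - wy)\<bar> powr (p / (p - 1))
            + \<eta> * \<bar>wx - wy\<bar> powr p"
    proof cases
      case 1
      then show ?thesis using main[OF h] by simp
    next
      \<comment> \<open>The estimate is invariant under exchanging the two points, as
        \<open>signed_pow\<close> is odd.\<close>
      case 2
      have neg: "signed_pow p (b - a) = - signed_pow p (a - b)" for a b
        using signed_pow_minus[of p "a - b"] by simp
      show ?thesis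
        using main[OF h(2,1,5,6,3,4,8,7,10,9) 2]
        unfolding neg[of ux uy] neg[of vx vy] neg[of zx zy] neg[of wx wy]
        by (simp add: algebra_simps abs_minus_commute)
    next
      case 3
      then show ?thesis
        using \<eta> by (simp add: C_def)
    qed
  qed
qed

text \<open>Since \<kappa> \<ge> 1, the slope of t^\<kappa> on [\<epsilon>, \<infinity>) is at least
  \<epsilon>^(\<kappa>-1); below \<epsilon> the truncation is constant.\<close>

lemma truncation_lipschitz:
  fixes a b \<epsilon> \<kappa> :: real
  assumes "0 \<le> a" "0 \<le> b" "0 < \<epsilon>" "1 \<le> \<kappa>"
  shows "\<bar>max 0 (a - \<epsilon>) - max 0 (b - \<epsilon>)\<bar> \<le> \<epsilon> powr (1 - \<kappa>) * \<bar>a powr \<kappa> - b powr \<kappa>\<bar>"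
proof -
  have main: "max 0 (a - \<epsilon>) - max 0 (b - \<epsilon>) \<le> \<epsilon> powr (1 - \<kappa>) * (a powr \<kappa> - b powr \<kappa>)"
    if "0 \<le> b" "b \<le> a" for a b
  proof (cases "a \<le> \<epsilon>")
    case True
    then show ?thesis using that assms by (simp add: powr_mono2)
  next
    case False
    \<comment> \<open>Raising b to \<epsilon> leaves its truncation unchanged and puts both
      endpoints into the range where the slope is bounded below.\<close>
    define t where "t = max b \<epsilon>"
    have t: "0 < t" "t \<le> a" "\<epsilon> \<le> t" "b \<le> t"
      using False that assms by (auto simp: t_def)
    have "\<epsilon> powr (\<kappa> - 1) * (a - t) \<le> t powr (\<kappa> - 1) * (a - t)"
      using t assms by (intro mult_right_mono powr_mono2) auto
    also have "\<dots> = t powr (\<kappa> - 1) * a - t powr \<kappa>"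
      using t powr_add[of t "\<kappa> - 1" 1] by (simp add: algebra_simps)
    also have "\<dots> \<le> a powr (\<kappa> - 1) * a - b powr \<kappa>"
      using t that assms by (intro diff_mono mult_right_mono powr_mono2) auto
    also have "\<dots> = a powr \<kappa> - b powr \<kappa>"
      using t powr_add[of a "\<kappa> - 1" 1] by simp
    finally have "\<epsilon> powr (1 - \<kappa>) * (\<epsilon> powr (\<kappa> - 1) * (a - t))
        \<le> \<epsilon> powr (1 - \<kappa>) * (a powr \<kappa> - b powr \<kappa>)"
      by (intro mult_left_mono) auto
    moreover have "\<epsilon> powr (1 - \<kappa>) * (\<epsilon> powr (\<kappa> - 1) * (a - t)) = a - t"
      using assms by (simp flip: mult.assoc powr_add)
    moreover have "max 0 (a - \<epsilon>) - max 0 (b - \<epsilon>) = a - t"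
      using False by (simp add: t_def max_def)
    ultimately show ?thesis by simp
  qed
  show ?thesis
  proof (cases "b \<le> a")
    case True
    have "b powr \<kappa> \<le> a powr \<kappa>" using True assms by (intro powr_mono2) auto
    then show ?thesis using main[of b a] True assms by simp
  next
    case False
    have "a powr \<kappa> \<le> b powr \<kappa>" using False assms by (intro powr_mono2) auto
    moreover have "max 0 (a - \<epsilon>) \<le> max 0 (b - \<epsilon>)" using False by simp
    ultimately show ?thesis
      using main[of a b] False assms by (simp add: abs_of_nonpos )
  qed
qed

section \<open>Exterior balls\<close>

text \<open>Locally the complement lies below a Lipschitz graph, so with each of its points it
  contains a downward cone of fixed aperture. A ball of radius proportional to t around x - t e fits
  into that cone.\<close>

lemma C11_exterior_cone:
  fixes \<Omega> :: "'a::euclidean_space set"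
  assumes "C11_boundary \<Omega>" "x0 \<in> frontier \<Omega>"
  obtains \<kappa> \<rho> where "0 < \<kappa>" "0 < \<rho>"
    "\<And>x t. \<lbrakk>x \<in> ball x0 \<rho>; x \<notin> \<Omega>; 0 < t; t \<le> \<rho>\<rbrakk> \<Longrightarrow> \<exists>c. dist x c = t \<and> ball c (\<kappa> * t) \<inter> \<Omega> = {}"
proof -
  from assms obtain r e g where r: "0 < r" and e: "norm e = 1" and g: "C11_on {y. y \<bullet> e = 0} g"
    and eq: "\<Omega> \<inter> ball x0 r = {x \<in> ball x0 r. g (x - (x \<bullet> e) *\<^sub>R e) < x \<bullet> e}"
    unfolding C11_boundary_def by blast
  define H where "H = {y. y \<bullet> e = 0}"
  define P where "P x = x - (x \<bullet> e) *\<^sub>R e" for x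
  have memb: "y \<in> \<Omega> \<longleftrightarrow> g (P y) < y \<bullet> e" if "y \<in> ball x0 r" for y
    using eq that unfolding P_def by blast
  from g obtain G L where L: "L-lipschitz_on H G"
    and der: "\<And>y. y \<in> H \<Longrightarrow> (g has_derivative (\<lambda>h. G y \<bullet> h)) (at y within H)"
    unfolding C11_on_def H_def by blast
  have ee: "e \<bullet> e = 1" using e by (simp add: dot_square_norm)
  have PH: "P x \<in> H" for x by (simp add: P_def H_def inner_diff_left ee)
  have Pdiff: "P x - P y = P (x - y)" for x y
    by (simp add: P_def algebra_simps)
  have Pnorm: "norm (P x) \<le> 2 * norm x" for x
  proof -
    have "norm (P x) \<le> norm x + norm ((x \<bullet> e) *\<^sub>R e)"
      unfolding P_def by (rule norm_triangle_ineq4)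
    also have "norm ((x \<bullet> e) *\<^sub>R e) \<le> norm x"
      using Cauchy_Schwarz_ineq2[of x e] e by simp
    finally show ?thesis by simp
  qed
  \<comment> \<open>The crude bound 2 for the norm of the projection makes \<open>P\<close> map the
    ball of radius r around x0 into \<open>S\<close>. On \<open>S\<close> the Lipschitz gradient is
    bounded by \<open>M\<close>.\<close>
  define S where "S = H \<inter> ball (P x0) (2 * r)"
  define M where "M = norm (G (P x0)) + 2 * r * L"
  have L0: "0 \<le> L" using L by (rule lipschitz_on_nonneg)
  have M0: "0 \<le> M" using L0 r by (simp add: M_def)
  have "convex H"
    unfolding H_def using convex_hyperplane[of e 0] by (simp add: inner_commute)
  then have "convex S" unfolding S_def by (intro convex_Int convex_ball)
  have lip: "\<bar>g y - g y'\<bar> \<le> M * norm (y - y')" if "y \<in> S" "y' \<in> S" for y y'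
  proof -
    have "norm (g y - g y') \<le> M * norm (y - y')"
    proof (rule differentiable_bound[OF \<open>convex S\<close>])
      fix x assume x: "x \<in> S"
      then show "(g has_derivative (\<lambda>h. G x \<bullet> h)) (at x within S)"
        by (intro has_derivative_subset[OF der]) (auto simp: S_def)
      have "dist (G x) (G (P x0)) \<le> L * dist x (P x0)"
        using L x PH by (auto simp: S_def intro: lipschitz_onD)
      also have "\<dots> \<le> L * (2 * r)"
        using x L0 by (intro mult_left_mono) (auto simp: S_def dist_commute)
      finally have "norm (G x) \<le> M"
        using norm_triangle_sub[of "G x" "G (P x0)"] by (simp add: M_def dist_norm ac_simps)
      then have "norm (G x \<bullet> h) \<le> M * norm h" for h
        using Cauchy_Schwarz_ineq2[of "G x" h] mult_right_mono[of "norm (G x)" M "norm h"] by simp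
      then show "onorm (\<lambda>h. G x \<bullet> h) \<le> M"
        by (intro onorm_bound M0)
    qed (use that in auto)
    then show ?thesis by simp
  qed
  \<comment> \<open>A point of the ball is lifted by at most \<kappa> t above x - t e, and the graph
    drops by at most 2 M \<kappa> t, the factor 2 coming from \<open>Pnorm\<close>. The choice makes
    these two add up to the descent t.\<close>
  define \<kappa> where "\<kappa> = 1 / (1 + 2 * M)"
  have \<kappa>: "0 < \<kappa>" "\<kappa> \<le> 1" "\<kappa> + 2 * M * \<kappa> = 1"
    using M0 by (auto simp: \<kappa>_def field_simps)
  show thesis
  proof
    \<comment> \<open>With r/4, a point of the new ball has distance less than r/4 + 2t \<le> 3r/4
      from x0, where the graph description is still valid.\<close>
    show "0 < \<kappa>" "0 < r / 4" using \<kappa> r by auto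
    fix x t assume x: "x \<in> ball x0 (r / 4)" "x \<notin> \<Omega>" and t: "0 < t" "t \<le> r / 4"
    have inS: "P y \<in> S" if "y \<in> ball x0 r" for y
      using Pnorm[of "x0 - y"] that by (auto simp: S_def PH dist_norm Pdiff)
    have xr: "x \<in> ball x0 r" using x r by auto
    then have gx: "x \<bullet> e \<le> g (P x)"
      using memb x by auto
    have "y \<notin> \<Omega>" if y: "y \<in> ball (x - t *\<^sub>R e) (\<kappa> * t)" for y
    proof
      assume "y \<in> \<Omega>"
      define h where "h = y - (x - t *\<^sub>R e)"
      have h: "norm h < \<kappa> * t" using y by (simp add: h_def dist_norm norm_minus_commute)
      have yx: "y - x = h - t *\<^sub>R e" by (simp add: h_def)
      have "\<kappa> * t \<le> t" using \<kappa> t by simp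
      have "norm (y - x) \<le> norm h + t"
        unfolding yx using norm_triangle_ineq4[of h "t *\<^sub>R e"] e t by simp
      then have "dist x0 y < r"
        using x(1) t(2) h \<open>\<kappa> * t \<le> t\<close> r dist_triangle[of x0 y x]
        unfolding dist_norm[of x y] norm_minus_commute[of x y] mem_ball by linarith
      then have yr: "y \<in> ball x0 r" by simp
      then have gy: "g (P y) < y \<bullet> e" using memb \<open>y \<in> \<Omega>\<close> by blast
      have "P y - P x = P h"
        unfolding Pdiff yx by (simp add: P_def ee inner_diff_left scaleR_diff_left)
      then have "\<bar>g (P y) - g (P x)\<bar> \<le> M * norm (P h)"
        using lip[OF inS[OF yr] inS[OF xr]] by simp
      also have "\<dots> \<le> M * (2 * (\<kappa> * t))"
        using Pnorm[of h] h M0 by (intro mult_left_mono) auto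
      finally have "g (P x) - g (P y) \<le> 2 * M * \<kappa> * t" by simp
      moreover have "y \<bullet> e \<le> x \<bullet> e + \<kappa> * t - t"
      proof -
        have "y \<bullet> e = x \<bullet> e + h \<bullet> e - t" by (simp add: h_def ee inner_diff_left)
        moreover have "h \<bullet> e \<le> norm h" using Cauchy_Schwarz_ineq2[of h e] e by simp
        ultimately show ?thesis using h by simp
      qed
      ultimately have "\<kappa> * t + 2 * M * \<kappa> * t > t"
        using gx gy by linarith
      then show False using \<kappa>(3) by (simp flip: distrib_right)
    qed
    then show "\<exists>c. dist x c = t \<and> ball c (\<kappa> * t) \<inter> \<Omega> = {}"
      using t e by (intro exI[of _ "x - t *\<^sub>R e"]) (auto simp: dist_norm)
  qed
qed

text \<open>Compactness of the boundary makes the constants of the local cones uniform. The cone is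
  attached at a boundary point that is no farther from x than the distance to the
  complement.\<close>

lemma C11_exterior_ball:
  fixes \<Omega> :: "'a::euclidean_space set"
  assumes "open \<Omega>" "bounded \<Omega>" "C11_boundary \<Omega>"
  obtains \<kappa> where "0 < \<kappa>" "\<kappa> \<le> 1"
    "\<And>x. x \<in> \<Omega> \<Longrightarrow> \<exists>c. dist x c \<le> 2 * infdist x (- \<Omega>) \<and> ball c (\<kappa> * infdist x (- \<Omega>)) \<inter> \<Omega> = {}"
proof -
  have "\<exists>\<kappa> \<rho>. 0 < \<kappa> \<and> 0 < \<rho> \<and> (\<forall>x t. x \<in> ball x0 \<rho> \<and> x \<notin> \<Omega> \<and> 0 < t \<and> t \<le> \<rho> \<longrightarrow>
      (\<exists>c. dist x c = t \<and> ball c (\<kappa> * t) \<inter> \<Omega> = {}))" if "x0 \<in> frontier \<Omega>" for x0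
    using C11_exterior_cone[OF assms(3) that] by metis
  then obtain k \<rho> where k\<rho>: "\<And>x0. x0 \<in> frontier \<Omega> \<Longrightarrow> 0 < k x0" "\<And>x0. x0 \<in> frontier \<Omega> \<Longrightarrow> 0 < \<rho> x0"
    "\<And>x0 x t. \<lbrakk>x0 \<in> frontier \<Omega>; x \<in> ball x0 (\<rho> x0); x \<notin> \<Omega>; 0 < t; t \<le> \<rho> x0\<rbrakk> \<Longrightarrow>
       \<exists>c. dist x c = t \<and> ball c (k x0 * t) \<inter> \<Omega> = {}"
    by metis
  have "compact (frontier \<Omega>)"
    using assms by (simp add: compact_frontier_bounded)
  moreover have "frontier \<Omega> \<subseteq> (\<Union>x0\<in>frontier \<Omega>. ball x0 (\<rho> x0))"
    using k\<rho>(2) by force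
  ultimately obtain F where F: "F \<subseteq> frontier \<Omega>" "finite F" "frontier \<Omega> \<subseteq> (\<Union>x0\<in>F. ball x0 (\<rho> x0))"
    using compactE_image[of "frontier \<Omega>" "frontier \<Omega>" "\<lambda>x0. ball x0 (\<rho> x0)"] by blast
  define \<kappa>0 where "\<kappa>0 = Min (insert 1 (k ` F))"
  define t0 where "t0 = Min (insert 1 (\<rho> ` F))"
  have pos: "0 < \<kappa>0" "0 < t0" "\<kappa>0 \<le> 1"
    using F k\<rho> by (auto simp: \<kappa>0_def t0_def subset_iff)
  have le: "\<kappa>0 \<le> k x0" "t0 \<le> \<rho> x0" if "x0 \<in> F" for x0
    using that F by (auto simp: \<kappa>0_def t0_def)
  obtain B where B: "\<And>x. x \<in> \<Omega> \<Longrightarrow> norm x \<le> B"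
    using assms(2) by (auto simp: bounded_iff)
  have "- \<Omega> \<noteq> {}"
    using assms(2) not_bounded_UNIV by (metis Compl_empty_eq double_complement)
  then obtain q where q: "q \<in> - \<Omega>" by blast
  define D where "D = \<bar>B\<bar> + norm q + 1"
  have D: "0 < D" "\<And>x. x \<in> \<Omega> \<Longrightarrow> infdist x (- \<Omega>) \<le> D"
  proof -
    show "0 < D" by (simp add: D_def add_nonneg_pos)
    fix x assume "x \<in> \<Omega>"
    have "infdist x (- \<Omega>) \<le> dist x q" using q by (rule infdist_le)
    also have "\<dots> \<le> norm x + norm q" by (simp add: dist_norm norm_triangle_ineq4)
    finally show "infdist x (- \<Omega>) \<le> D" using B[OF \<open>x \<in> \<Omega>\<close>] by (simp add: D_def)
  qed
  \<comment> \<open>The cones have height \<open>t0\<close> only, whereas the distance can be as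
    large as \<open>D\<close>. Scaling the step by \<tau> makes it admissible for points deep inside
    as well.\<close>
  define \<tau> where "\<tau> = min 1 (t0 / D)"
  have \<tau>: "0 < \<tau>" "\<tau> \<le> 1" "\<tau> * D \<le> t0" using pos D(1) by (auto simp: \<tau>_def min_def field_simps)
  show thesis
  proof
    show "0 < \<kappa>0 * \<tau>" "\<kappa>0 * \<tau> \<le> 1"
      using pos \<tau> by (auto intro: mult_le_one)
    fix x assume x: "x \<in> \<Omega>"
    let ?d = "infdist x (- \<Omega>)"
    have closed: "closed (- \<Omega>)" using assms(1) by (rule closed_Compl)
    have d: "0 < ?d"
      using x closed \<open>- \<Omega> \<noteq> {}\<close> infdist_pos_not_in_closed[of "- \<Omega>" x] by auto
    obtain y where y: "y \<in> - \<Omega>" "?d = dist x y"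
      using infdist_attains_inf[OF closed \<open>- \<Omega> \<noteq> {}\<close>] by blast
    \<comment> \<open>The segment to a nearest point of the complement crosses the boundary, at a
      distance from x not exceeding its length.\<close>
    have "closed_segment x y \<inter> frontier \<Omega> \<noteq> {}"
      by (rule connected_Int_frontier) (use x y in auto)
    then obtain x2 where x2: "x2 \<in> closed_segment x y" "x2 \<in> frontier \<Omega>" by blast
    have x2O: "x2 \<notin> \<Omega>" using x2 assms(1) by (simp add: frontier_def interior_open)
    have dx2: "dist x x2 \<le> ?d"
      using x2(1) y(2) segment_bound(1)[OF x2(1)] by (simp add: dist_norm norm_minus_commute)
    obtain x0 where x0: "x0 \<in> F" "x2 \<in> ball x0 (\<rho> x0)" using F(3) x2(2) by blast
    have "\<tau> * ?d \<le> \<tau> * D" using D(2)[OF x] \<tau> by (intro mult_left_mono) auto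
    also have "\<dots> \<le> \<rho> x0" using \<tau>(3) le(2)[OF x0(1)] by simp
    finally obtain c where c: "dist x2 c = \<tau> * ?d" "ball c (k x0 * (\<tau> * ?d)) \<inter> \<Omega> = {}"
      using k\<rho>(3)[of x0 x2 "\<tau> * ?d"] F x0 x2O d \<tau> by auto
    have "\<kappa>0 * \<tau> * ?d \<le> k x0 * (\<tau> * ?d)"
      using le(1)[OF x0(1)] d \<tau> by (simp add: mult.assoc)
    then have "ball c (\<kappa>0 * \<tau> * ?d) \<inter> \<Omega> = {}"
      using c(2) subset_ball[of "\<kappa>0 * \<tau> * ?d" "k x0 * (\<tau> * ?d)" c] by blast
    moreover have "dist x c \<le> 2 * ?d"
    proof -
      have "\<tau> * ?d \<le> ?d" using \<tau> d by simp
      then show ?thesis using dist_triangle[of x c x2] dx2 c(1) by simp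
    qed
    ultimately show "\<exists>c. dist x c \<le> 2 * ?d \<and> ball c (\<kappa>0 * \<tau> * ?d) \<inter> \<Omega> = {}" by blast
  qed
qed

section \<open>Riesz kernels and the fractional Hardy inequality\<close>

text \<open>Needed for Tonelli on \<open>lebesgue \<Otimes>\<^sub>M lebesgue\<close>. A countable
  cover for \<open>lborel\<close> also serves for its completion, since the measures agree on Borel
  sets.\<close>

lemma sigma_finite_lebesgue: "sigma_finite_measure (lebesgue :: 'a::euclidean_space measure)"
proof
  obtain A :: "'a set set" where A: "countable A \<and> A \<subseteq> sets lborel \<and> \<Union>A = space lborel \<and>
      (\<forall>a\<in>A. emeasure lborel a \<noteq> \<infinity>)"
    using lborel.sigma_finite_countable by (rule exE)
  have "emeasure lebesgue a = emeasure lborel a" if "a \<in> A" for a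
  proof -
    have "a \<in> sets lborel" using A that by blast
    then show ?thesis by simp
  qed
  then show "\<exists>A::'a set set. countable A \<and> A \<subseteq> sets lebesgue \<and> \<Union>A = space lebesgue \<and>
      (\<forall>a\<in>A. emeasure lebesgue a \<noteq> \<infinity>)"
    using A by (intro exI[of _ A]) (simp add: subset_iff)
qed

interpretation lebesgue: sigma_finite_measure "lebesgue :: 'a::euclidean_space measure"
  by (rule sigma_finite_lebesgue)

interpretation lebesgue_pair: pair_sigma_finite
    "lebesgue :: 'a::euclidean_space measure" "lebesgue :: 'b::euclidean_space measure" ..

lemma measurable_lebesgue_borel [measurable]: "(\<lambda>x. x) \<in> lebesgue \<rightarrow>\<^sub>M borel"
  by (intro measurable_completion) simp

lemma measurable_fst_lebesgue_borel [measurable]: "fst \<in> lebesgue \<Otimes>\<^sub>M M \<rightarrow>\<^sub>M borel"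
  by (rule measurable_compose[OF measurable_fst measurable_lebesgue_borel])

lemma measurable_snd_lebesgue_borel [measurable]: "snd \<in> M \<Otimes>\<^sub>M lebesgue \<rightarrow>\<^sub>M borel"
  by (rule measurable_compose[OF measurable_snd measurable_lebesgue_borel])

lemma AE_lebesgue_pair:
  fixes P :: "'a::euclidean_space \<Rightarrow> bool"
  assumes "AE x in lebesgue. P x"
  shows "AE z in lebesgue \<Otimes>\<^sub>M lebesgue. P (fst z) \<and> P (snd z)"
proof -
  obtain N where N: "N \<in> null_sets lebesgue" "{x. \<not> P x} \<subseteq> N"
    using assms by (auto simp: eventually_ae_filter)
  have [measurable]: "N \<in> sets lebesgue" using N by auto
  have "AE x in lebesgue. x \<notin> N"
    using N(1) by (rule AE_not_in)
  then have "AE z in lebesgue \<Otimes>\<^sub>M lebesgue. fst z \<notin> N \<and> snd z \<notin> N"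
    by (intro lebesgue_pair.AE_pair_measure) (auto elim: eventually_mono)
  then show ?thesis
    by (rule eventually_mono) (use N in blast)
qed

text \<open>On the diagonal the value is 0, since \<open>0 powr _\<close> and division by 0 are both
  0; this agrees with the convention in \<open>gagliardo\<close>.\<close>

definition riesz_kernel :: "real \<Rightarrow> 'a::euclidean_space \<times> 'a \<Rightarrow> real" where
  "riesz_kernel \<sigma> z = 1 / norm (fst z - snd z) powr (real DIM('a) + \<sigma>)"

lemma riesz_kernel_nonneg [simp]: "0 \<le> riesz_kernel \<sigma> z"
  by (simp add: riesz_kernel_def)

lemma riesz_kernel_commute: "riesz_kernel \<sigma> (x, y) = riesz_kernel \<sigma> (y, x)"
  by (simp add: riesz_kernel_def norm_minus_commute)

lemma borel_measurable_riesz_kernel [measurable]: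
  "riesz_kernel \<sigma> \<in> borel_measurable (lebesgue \<Otimes>\<^sub>M lebesgue)"
  unfolding riesz_kernel_def [abs_def] by measurable

lemma gagliardo_riesz_kernel:
  "gagliardo s p \<omega> u = (\<integral>\<^sup>+ z. ennreal (\<bar>u (fst z) - u (snd z)\<bar> powr p * riesz_kernel (s * p) z)
      * indicator (\<omega> \<times> \<omega>) z \<partial>(lebesgue \<Otimes>\<^sub>M lebesgue))"
  by (simp add: gagliardo_def riesz_kernel_def case_prod_beta)

lemma ex_power_between:
  fixes t :: real
  assumes "1 \<le> t"
  obtains k :: nat where "2 ^ k \<le> t" "t < 2 ^ Suc k"
proof
  let ?k = "nat \<lfloor>log 2 t\<rfloor>"
  have 0: "0 \<le> log 2 t" using assms by simp
  have "real ?k \<le> log 2 t" "log 2 t < real (Suc ?k)"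
    using 0 by linarith+
  then have "2 powr real ?k \<le> t" "t < 2 powr real (Suc ?k)"
    using assms by (simp_all only: le_log_iff log_less_iff)
  then show "2 ^ ?k \<le> t" "t < 2 ^ Suc ?k"
    by (simp_all add: powr_realpow del: of_nat_Suc)
qed

lemma suminf_ennreal_geometric:
  fixes c q :: real
  assumes "0 \<le> c" "0 \<le> q" "q < 1"
  shows "(\<Sum>k. ennreal (c * q ^ k)) = ennreal (c / (1 - q))"
proof -
  have "(\<lambda>k. c * q ^ k) sums (c * (1 / (1 - q)))"
    using assms by (intro sums_mult geometric_sums) auto
  then show ?thesis
    using assms by (subst suminf_ennreal2) (auto simp: sums_iff)
qed

text \<open>The space is cut into dyadic annuli around the centre.\<close>

lemma nn_integral_riesz_kernel_bound:
  fixes p \<sigma> :: real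
  assumes "0 < \<sigma>" "\<sigma> < p"
  obtains C where "0 \<le> C"
    "\<And>(y::'a::euclidean_space) d. 0 < d \<Longrightarrow>
      (\<integral>\<^sup>+ x. ennreal (min 1 (4 * norm (x - y) / d) powr p * riesz_kernel \<sigma> (x, y)) \<partial>lebesgue)
        \<le> ennreal (C * d powr (- \<sigma>))"
proof -
  define N where "N = real DIM('a)"
  define V where "V = unit_ball_vol N"
  \<comment> \<open>The outer annuli contribute a geometric series of ratio 2^(-\<sigma>),
    convergent since \<sigma> > 0. The inner ones, where the minimum gains a factor |x-y|^p, have
    ratio 2^(\<sigma>-p), convergent since \<sigma> < p.\<close>
  define q1 where "q1 = 2 powr (- \<sigma>)"
  define q2 where "q2 = 2 powr (\<sigma> - p)"
  have V: "0 \<le> V" by (simp add: V_def N_def unit_ball_vol_nonneg)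
  have q: "0 \<le> q1" "q1 < 1" "0 \<le> q2" "q2 < 1"
    using assms by (auto simp: q1_def q2_def powr_less_one)
  define C1 where "C1 = V * 2 powr N"
  define C2 where "C2 = V * 4 powr p * 2 powr (N + \<sigma>)"
  define C where "C = C1 / (1 - q1) + C2 / (1 - q2)"
  have C12: "0 \<le> C1" "0 \<le> C2" using V by (auto simp: C1_def C2_def)
  have vol: "emeasure lborel (cball y r) = ennreal (V * r powr N)" if "0 < r" for y :: 'a and r
    using that by (simp add: emeasure_cball V_def N_def powr_realpow)
  have bnd: "(\<integral>\<^sup>+ x. ennreal (min 1 (4 * norm (x - y) / d) powr p * riesz_kernel \<sigma> (x, y)) \<partial>lebesgue)
        \<le> ennreal (C * d powr (- \<sigma>))" if d: "0 < d" for y :: 'a and d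
  proof -
    define f where "f x = min 1 (4 * norm (x - y) / d) powr p * riesz_kernel \<sigma> (x, y)" for x
    \<comment> \<open>\<open>b1 k\<close> bounds the integrand where 2^k d \<le> |x-y| < 2^(k+1) d,
      and \<open>r1 k\<close> is the radius of a ball containing this annulus. \<open>b2\<close> and
      \<open>r2\<close> do the same for the annuli d/2^(k+1) < |x-y| \<le> d/2^k.\<close>
    define b1 where "b1 k = (2 ^ k * d) powr (- (N + \<sigma>))" for k :: nat
    define r1 where "r1 k = 2 * 2 ^ k * d" for k :: nat
    define b2 where "b2 k = (4 / 2 ^ k) powr p * (d / (2 * 2 ^ k)) powr (- (N + \<sigma>))" for k :: nat
    define r2 where "r2 k = d / 2 ^ k" for k :: nat
    let ?S1 = "\<lambda>x. \<Sum>k. ennreal (b1 k) * indicator (cball y (r1 k)) x"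
    let ?S2 = "\<lambda>x. \<Sum>k. ennreal (b2 k) * indicator (cball y (r2 k)) x"
    have term_le: "g k \<le> (\<Sum>k. g k)" for g :: "nat \<Rightarrow> ennreal" and k
      using sum_le_suminf[of g "{k}"] by simp
    have ptw: "ennreal (f x) \<le> ?S1 x + ?S2 x" for x
    proof (cases "x = y")
      case True
      then show ?thesis by (simp add: f_def riesz_kernel_def)
    next
      case False
      define t where "t = norm (x - y) / d"
      have t: "0 < t" "norm (x - y) = t * d" using False d by (auto simp: t_def)
      have fx: "f x = min 1 (4 * t) powr p * (t * d) powr (- (N + \<sigma>))"
        unfolding f_def riesz_kernel_def powr_minus_divide fst_conv snd_conv t(2) N_def using d by simp
      show ?thesis
      proof (cases "1 \<le> t")
        case True
        then obtain k where k: "2 ^ k \<le> t" "t < 2 ^ Suc k" by (rule ex_power_between)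
        have "f x \<le> 1 * b1 k"
          unfolding fx b1_def
          using k d t assms by (intro mult_mono powr_le1 powr_mono2') (auto simp: N_def)
        moreover have "x \<in> cball y (r1 k)"
          using k d t by (simp add: r1_def dist_norm norm_minus_commute)
        ultimately have "ennreal (f x) \<le> ennreal (b1 k) * indicator (cball y (r1 k)) x"
          by (simp add: ennreal_leI)
        also have "\<dots> \<le> ?S1 x"
          by (rule term_le)
        finally show ?thesis by (simp add: add_increasing2)
      next
        case False
        then have "1 \<le> 1 / t" using t by simp
        then obtain k where k: "2 ^ k \<le> 1 / t" "1 / t < 2 ^ Suc k" by (rule ex_power_between)
        have k': "t \<le> 1 / 2 ^ k" "1 / (2 * 2 ^ k) \<le> t"
          using k t by (simp_all add: field_simps)
        have "f x \<le> b2 k"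
          unfolding fx b2_def
        proof (rule mult_mono)
          show "min 1 (4 * t) powr p \<le> (4 / 2 ^ k) powr p"
            using k'(1) t assms by (intro powr_mono2) auto
          show "(t * d) powr (- (N + \<sigma>)) \<le> (d / (2 * 2 ^ k)) powr (- (N + \<sigma>))"
            using mult_right_mono[OF k'(2), of d] d assms by (intro powr_mono2') (auto simp: N_def)
        qed simp_all
        moreover have "x \<in> cball y (r2 k)"
          using mult_right_mono[OF k'(1), of d] d t by (simp add: r2_def dist_norm norm_minus_commute)
        ultimately have "ennreal (f x) \<le> ennreal (b2 k) * indicator (cball y (r2 k)) x"
          by (simp add: ennreal_leI)
        also have "\<dots> \<le> ?S2 x"
          by (rule term_le)
        finally show ?thesis by (simp add: add_increasing)
      qed
    qed
    have pow2: "(2 ^ k) powr x = (2 powr x) ^ k" for k :: nat and x :: real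
      by (simp add: powr_powr mult.commute flip: powr_realpow)
    have D1: "b1 k * (V * r1 k powr N) = C1 * d powr (- \<sigma>) * q1 ^ k" for k
    proof -
      define m where "m = 2 ^ k * d"
      have m: "0 < m" using d by (simp add: m_def)
      have "b1 k * (V * r1 k powr N) = C1 * (m powr (- (N + \<sigma>)) * m powr N)"
        using m by (simp add: b1_def r1_def C1_def m_def powr_mult mult.assoc)
      also have "m powr (- (N + \<sigma>)) * m powr N = m powr (- \<sigma>)"
        by (subst powr_add[symmetric]) simp
      also have "\<dots> = d powr (- \<sigma>) * q1 ^ k"
        using d by (simp add: m_def powr_mult pow2 q1_def)
      finally show ?thesis by (simp add: mult.assoc)
    qed
    have D2: "b2 k * (V * r2 k powr N) = C2 * d powr (- \<sigma>) * q2 ^ k" for k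
    proof -
      define m where "m = d / 2 ^ k"
      have m: "0 < m" using d by (simp add: m_def)
      have "b2 k = (4 / 2 ^ k) powr p * (m / 2) powr (- (N + \<sigma>))"
        by (simp add: b2_def m_def mult.commute)
      also have "(4 / 2 ^ k) powr p = 4 powr p * (2 ^ k) powr (- p)"
        by (simp add: powr_divide powr_minus_divide)
      also have "(m / 2) powr (- (N + \<sigma>)) = m powr (- (N + \<sigma>)) * 2 powr (N + \<sigma>)"
        using m by (simp only: powr_divide powr_minus_divide) simp
      finally have "b2 k * (V * r2 k powr N)
          = C2 * ((2 ^ k) powr (- p) * (m powr (- (N + \<sigma>)) * m powr N))"
        by (simp add: r2_def C2_def m_def ac_simps)
      also have "m powr (- (N + \<sigma>)) * m powr N = m powr (- \<sigma>)"
        by (subst powr_add[symmetric]) simp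
      also have "m powr (- \<sigma>) = d powr (- \<sigma>) * (2 ^ k) powr \<sigma>"
        using d by (simp add: m_def powr_divide powr_minus_divide)
      also have "(2 ^ k) powr (- p) * (d powr (- \<sigma>) * (2 ^ k) powr \<sigma>)
          = d powr (- \<sigma>) * (2 ^ k) powr (\<sigma> - p)"
        by (subst diff_conv_add_uminus, subst powr_add) (simp add: ac_simps)
      finally show ?thesis by (simp add: pow2 q2_def mult.assoc)
    qed
    have nonneg: "0 \<le> b1 k" "0 \<le> b2 k" "0 < r1 k" "0 < r2 k" for k
      using d by (auto simp: b1_def b2_def r1_def r2_def)
    have "(\<integral>\<^sup>+ x. ennreal (f x) \<partial>lborel) \<le> (\<integral>\<^sup>+ x. ?S1 x + ?S2 x \<partial>lborel)"
      by (intro nn_integral_mono ptw)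
    also have "\<dots> = (\<Sum>k. ennreal (b1 k) * emeasure lborel (cball y (r1 k)))
        + (\<Sum>k. ennreal (b2 k) * emeasure lborel (cball y (r2 k)))"
    proof -
      have [measurable]: "cball y r \<in> sets borel" for r
        by simp
      show ?thesis
        by (subst nn_integral_add, measurable)
           (subst (1 2) nn_integral_suminf, simp_all add: nn_integral_cmult_indicator)
    qed
    also have "\<dots> = (\<Sum>k. ennreal (C1 * d powr (- \<sigma>) * q1 ^ k))
        + (\<Sum>k. ennreal (C2 * d powr (- \<sigma>) * q2 ^ k))"
      using nonneg by (simp only: vol D1[symmetric] D2[symmetric] ennreal_mult')
    also have "\<dots> = ennreal (C1 * d powr (- \<sigma>) / (1 - q1)) + ennreal (C2 * d powr (- \<sigma>) / (1 - q2))"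
      using C12 q by (subst (1 2) suminf_ennreal_geometric) auto
    also have "\<dots> = ennreal (C * d powr (- \<sigma>))"
      using C12 q by (simp add: C_def algebra_simps flip: ennreal_plus)
    finally show ?thesis by (simp add: nn_integral_completion f_def)
  qed
  have "0 \<le> C" using C12 q by (simp add: C_def)
  then show thesis using bnd by (rule that)
qed

section \<open>Distance to the complement and the fractional Hardy inequality\<close>

lemma Compl_bounded_nonempty:
  fixes \<Omega> :: "'a::euclidean_space set"
  assumes "bounded \<Omega>"
  shows "- \<Omega> \<noteq> {}"
  using assms not_bounded_UNIV by (metis Compl_empty_eq double_complement)

lemma infdist_Compl_pos_iff:
  fixes \<Omega> :: "'a::euclidean_space set"
  assumes "open \<Omega>" "bounded \<Omega>"
  shows "0 < infdist x (- \<Omega>) \<longleftrightarrow> x \<in> \<Omega>"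
proof -
  have "closed (- \<Omega>)" using assms(1) by (rule closed_Compl)
  then show ?thesis
    using Compl_bounded_nonempty[OF assms(2)] infdist_pos_not_in_closed[of "- \<Omega>" x]
    by (cases "x \<in> \<Omega>") auto
qed

lemma borel_measurable_infdist_lebesgue [measurable]:
  "(\<lambda>x. infdist x A) \<in> borel_measurable lebesgue"
proof -
  have "(\<lambda>x. infdist x A) \<in> borel_measurable borel"
    by (intro borel_measurable_continuous_onI continuous_on_infdist continuous_on_id)
  then show ?thesis
    by (intro measurable_completion) simp
qed

text \<open>The exterior ball makes the nonlocal interaction with the complement dominate the
  Hardy weight.\<close>

lemma C11_exterior_interaction:
  fixes \<Omega> :: "'a::euclidean_space set"
  assumes "open \<Omega>" "bounded \<Omega>" "C11_boundary \<Omega>" "0 < \<sigma>"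
  obtains c where "0 < c"
    "\<And>y. y \<in> \<Omega> \<Longrightarrow> ennreal (c * infdist y (- \<Omega>) powr (- \<sigma>))
       \<le> (\<integral>\<^sup>+ x. ennreal (riesz_kernel \<sigma> (x, y)) * indicator (- \<Omega>) x \<partial>lebesgue)"
proof -
  obtain \<kappa> where \<kappa>: "0 < \<kappa>" "\<kappa> \<le> 1"
    "\<And>x. x \<in> \<Omega> \<Longrightarrow> \<exists>c. dist x c \<le> 2 * infdist x (- \<Omega>) \<and> ball c (\<kappa> * infdist x (- \<Omega>)) \<inter> \<Omega> = {}"
    using C11_exterior_ball[OF assms(1-3)] by metis
  define N where "N = real DIM('a)"
  define V where "V = unit_ball_vol N"
  have V: "0 < V" by (simp add: V_def N_def)
  \<comment> \<open>Every point of the exterior ball has distance at most 2d + \<kappa> d \<le> 3d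
    from y; the constant is the kernel at distance 3d times the volume of the ball, freed of its
    power of d.\<close>
  define c0 where "c0 = 3 powr (- (N + \<sigma>)) * V * \<kappa> powr N"
  show thesis
  proof
    show "0 < c0" using V \<kappa> by (simp add: c0_def)
    fix y assume y: "y \<in> \<Omega>"
    define d where "d = infdist y (- \<Omega>)"
    have d: "0 < d" using y infdist_Compl_pos_iff[OF assms(1,2)] by (simp add: d_def)
    obtain c where c: "dist y c \<le> 2 * d" "ball c (\<kappa> * d) \<inter> \<Omega> = {}"
      using \<kappa>(3)[OF y] by (auto simp: d_def)
    have vol: "emeasure lborel (ball c (\<kappa> * d)) = ennreal (V * (\<kappa> * d) powr N)"
      using \<kappa> d by (simp add: emeasure_ball V_def N_def powr_realpow)
    have *: "(3 * d) powr (- (N + \<sigma>)) \<le> riesz_kernel \<sigma> (x, y)" if x: "x \<in> ball c (\<kappa> * d)" for x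
    proof -
      have "x \<noteq> y" using x c(2) y by auto
      have "\<kappa> * d \<le> d" using \<kappa> d by simp
      then have "dist x y \<le> 3 * d"
        using x c(1) dist_triangle[of x y c] by (simp add: dist_commute)
      then have "(3 * d) powr (- (N + \<sigma>)) \<le> norm (x - y) powr (- (N + \<sigma>))"
        using \<open>x \<noteq> y\<close> assms(4) by (intro powr_mono2') (auto simp: dist_norm N_def)
      then show ?thesis
        unfolding riesz_kernel_def N_def powr_minus_divide by simp
    qed
    have "c0 * d powr (- \<sigma>) = (3 * d) powr (- (N + \<sigma>)) * (V * (\<kappa> * d) powr N)"
    proof -
      have "d powr (- \<sigma>) = d powr (- (N + \<sigma>)) * d powr N"
        by (subst powr_add[symmetric]) simp
      then show ?thesis
        using d \<kappa> unfolding c0_def by (simp add: powr_mult ac_simps)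
    qed
    then have "ennreal (c0 * d powr (- \<sigma>))
        = ennreal ((3 * d) powr (- (N + \<sigma>))) * emeasure lborel (ball c (\<kappa> * d))"
      by (simp add: vol ennreal_mult')
    also have "\<dots> = (\<integral>\<^sup>+ x. ennreal ((3 * d) powr (- (N + \<sigma>))) * indicator (ball c (\<kappa> * d)) x \<partial>lborel)"
      by (simp add: nn_integral_cmult_indicator)
    also have "\<dots> \<le> (\<integral>\<^sup>+ x. ennreal (riesz_kernel \<sigma> (x, y)) * indicator (- \<Omega>) x \<partial>lborel)"
      using * c(2) by (intro nn_integral_mono) (auto simp: indicator_def ennreal_leI)
    finally show "ennreal (c0 * infdist y (- \<Omega>) powr (- \<sigma>))
       \<le> (\<integral>\<^sup>+ x. ennreal (riesz_kernel \<sigma> (x, y)) * indicator (- \<Omega>) x \<partial>lebesgue)"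
      by (simp add: nn_integral_completion d_def)
  qed
qed

text \<open>For x outside \<Omega> the increment of z is just |z(y)|. So this part of the energy
  alone is |z(y)|^p times the interaction of y with the complement, which dominates the Hardy
  weight. As the energy is taken over the whole space, s p = 1 is not exceptional.\<close>

lemma fractional_hardy:
  fixes \<Omega> :: "'a::euclidean_space set"
  assumes "open \<Omega>" "bounded \<Omega>" "C11_boundary \<Omega>" "0 < s * p"
  obtains C where "0 \<le> C"
    "\<And>z. \<lbrakk>z \<in> borel_measurable lebesgue; \<And>x. x \<notin> \<Omega> \<Longrightarrow> z x = 0\<rbrakk> \<Longrightarrow>
      (\<integral>\<^sup>+ y. ennreal (\<bar>z y\<bar> powr p * infdist y (- \<Omega>) powr (- (s * p))) \<partial>lebesgue)
        \<le> ennreal C * gagliardo s p UNIV z"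
proof -
  define \<sigma> where "\<sigma> = s * p"
  obtain c where c: "0 < c"
    "\<And>y. y \<in> \<Omega> \<Longrightarrow> ennreal (c * infdist y (- \<Omega>) powr (- \<sigma>))
       \<le> (\<integral>\<^sup>+ x. ennreal (riesz_kernel \<sigma> (x, y)) * indicator (- \<Omega>) x \<partial>lebesgue)"
    using C11_exterior_interaction[OF assms(1-3), of \<sigma>] assms(4) unfolding \<sigma>_def by blast
  show thesis
  proof
    show "0 \<le> 1 / c" using c by simp
    fix z :: "'a \<Rightarrow> real"
    assume z [measurable]: "z \<in> borel_measurable lebesgue" and z0: "\<And>x. x \<notin> \<Omega> \<Longrightarrow> z x = 0"
    have \<Omega> [measurable]: "- \<Omega> \<in> sets lebesgue" using assms(1) by simp
    let ?q = "\<lambda>w. ennreal (\<bar>z (fst w) - z (snd w)\<bar> powr p * riesz_kernel \<sigma> w)"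
    have "ennreal (\<bar>z y\<bar> powr p * infdist y (- \<Omega>) powr (- \<sigma>))
        \<le> ennreal (1 / c) * (\<integral>\<^sup>+ x. ?q (x, y) \<partial>lebesgue)" for y
    proof (cases "y \<in> \<Omega>")
      case False
      then show ?thesis by (simp add: z0)
    next
      case True
      have "ennreal (\<bar>z y\<bar> powr p * infdist y (- \<Omega>) powr (- \<sigma>))
        = ennreal (1 / c) * (ennreal (\<bar>z y\<bar> powr p) * ennreal (c * infdist y (- \<Omega>) powr (- \<sigma>)))"
        using c(1) by (simp flip: ennreal_mult')
      also have "\<dots> \<le> ennreal (1 / c) * (ennreal (\<bar>z y\<bar> powr p) *
          (\<integral>\<^sup>+ x. ennreal (riesz_kernel \<sigma> (x, y)) * indicator (- \<Omega>) x \<partial>lebesgue))"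
        by (intro mult_left_mono c(2) True) auto
      also have "ennreal (\<bar>z y\<bar> powr p) *
          (\<integral>\<^sup>+ x. ennreal (riesz_kernel \<sigma> (x, y)) * indicator (- \<Omega>) x \<partial>lebesgue)
          = (\<integral>\<^sup>+ x. ennreal (\<bar>z y\<bar> powr p) * (ennreal (riesz_kernel \<sigma> (x, y)) * indicator (- \<Omega>) x) \<partial>lebesgue)"
        by (rule nn_integral_cmult[symmetric]) measurable
      also have "\<dots> \<le> (\<integral>\<^sup>+ x. ?q (x, y) \<partial>lebesgue)"
        by (intro nn_integral_mono) (auto simp: indicator_def z0 ennreal_mult')
      finally show ?thesis by (simp add: mult_left_mono)
    qed
    then have "(\<integral>\<^sup>+ y. ennreal (\<bar>z y\<bar> powr p * infdist y (- \<Omega>) powr (- \<sigma>)) \<partial>lebesgue)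
      \<le> (\<integral>\<^sup>+ y. ennreal (1 / c) * (\<integral>\<^sup>+ x. ?q (x, y) \<partial>lebesgue) \<partial>lebesgue)"
      by (intro nn_integral_mono) 
    also have "\<dots> = ennreal (1 / c) * (\<integral>\<^sup>+ y. \<integral>\<^sup>+ x. ?q (x, y) \<partial>lebesgue \<partial>lebesgue)"
      by (rule nn_integral_cmult) measurable
    also have "(\<integral>\<^sup>+ y. \<integral>\<^sup>+ x. ?q (x, y) \<partial>lebesgue \<partial>lebesgue) = gagliardo s p UNIV z"
      unfolding gagliardo_riesz_kernel \<sigma>_def
      by (subst lebesgue_pair.nn_integral_snd) simp_all
    finally show "(\<integral>\<^sup>+ y. ennreal (\<bar>z y\<bar> powr p * infdist y (- \<Omega>) powr (- (s * p))) \<partial>lebesgue)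
        \<le> ennreal (1 / c) * gagliardo s p UNIV z"
      by (simp add: \<sigma>_def)
  qed
qed

text \<open>In terms of the distance: 0 up to 1/n, 1 from 2/n on, and linear in between. The support
  thus keeps a positive distance from the boundary. For n = 0 it is the zero function.\<close>

definition cutoff :: "'a::euclidean_space set \<Rightarrow> nat \<Rightarrow> 'a \<Rightarrow> real" where
  "cutoff \<Omega> n x = min 1 (max 0 (real n * infdist x (- \<Omega>) - 1))"

lemma cutoff_bounds: "0 \<le> cutoff \<Omega> n x" "cutoff \<Omega> n x \<le> 1"
  by (auto simp: cutoff_def)

text \<open>This is what later makes the differences of the right-hand sides increase with
  n.\<close>

lemma cutoff_mono: "m \<le> n \<Longrightarrow> cutoff \<Omega> m x \<le> cutoff \<Omega> n x"
  unfolding cutoff_def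
  by (intro min.mono max.mono diff_mono mult_right_mono) (auto simp: infdist_nonneg)

lemma cutoff_support: "cutoff \<Omega> n x \<noteq> 0 \<Longrightarrow> 1 < real n * infdist x (- \<Omega>)"
  by (auto simp: cutoff_def)

lemma borel_measurable_cutoff [measurable]: "cutoff \<Omega> n \<in> borel_measurable lebesgue"
  unfolding cutoff_def [abs_def] by measurable

lemma cutoff_tendsto:
  assumes "0 < infdist x (- \<Omega>)"
  shows "(\<lambda>n. cutoff \<Omega> n x) \<longlonglongrightarrow> 1"
proof (rule tendsto_eventually)
  obtain m :: nat where m: "2 / infdist x (- \<Omega>) < m" using reals_Archimedean2 by blast
  have "cutoff \<Omega> n x = 1" if "m \<le> n" for n
  proof -
    have "2 / infdist x (- \<Omega>) < real n" using m that by linarith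
    then show ?thesis using assms by (simp add: cutoff_def field_simps)
  qed
  then show "\<forall>\<^sub>F n in sequentially. cutoff \<Omega> n x = 1"
    by (auto simp: eventually_sequentially)
qed

text \<open>The cut-off varies only where the distance to the boundary is of order \<open>1 / n\<close>, so
  that its modulus of continuity has a bound which does not depend on \<open>n\<close>.\<close>

lemma cutoff_diff_le:
  assumes "0 < infdist y (- \<Omega>)"
  shows "\<bar>cutoff \<Omega> n x - cutoff \<Omega> n y\<bar> \<le> min 1 (4 * norm (x - y) / infdist y (- \<Omega>))"
proof -
  let ?dx = "infdist x (- \<Omega>)" and ?dy = "infdist y (- \<Omega>)"
  have d: "\<bar>?dx - ?dy\<bar> \<le> norm (x - y)"
    using infdist_triangle_abs[of x "- \<Omega>" y] by (simp add: dist_norm)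
  have le1: "\<bar>cutoff \<Omega> n x - cutoff \<Omega> n y\<bar> \<le> 1"
    using cutoff_bounds[of \<Omega> n x] cutoff_bounds[of \<Omega> n y] by linarith
  moreover have "\<bar>cutoff \<Omega> n x - cutoff \<Omega> n y\<bar> \<le> 4 * norm (x - y) / ?dy"
  proof -
    \<comment> \<open>Either the points are far apart compared with the distance of y to the
      boundary, or y lies in the layer where the Lipschitz constant n is at most 4 over that
      distance, or both points are so deep inside that the cut-off is 1 at each.\<close>
    consider "?dy \<le> 4 * norm (x - y)" | "real n * ?dy \<le> 4"
      | "4 * norm (x - y) < ?dy" "4 < real n * ?dy" by linarith
    then show ?thesis
    proof cases
      case 1
      then have "1 \<le> 4 * norm (x - y) / ?dy" using assms by simp
      then show ?thesis using le1 by linarith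
    next
      case 2
      have "\<bar>cutoff \<Omega> n x - cutoff \<Omega> n y\<bar> \<le> \<bar>real n * ?dx - real n * ?dy\<bar>"
        unfolding cutoff_def by linarith
      also have "\<dots> = real n * \<bar>?dx - ?dy\<bar>"
        by (simp add: abs_mult flip: right_diff_distrib)
      also have "\<dots> \<le> real n * norm (x - y)"
        using d by (intro mult_left_mono) auto
      also have "\<dots> \<le> 4 / ?dy * norm (x - y)"
        using 2 assms by (intro mult_right_mono) (auto simp: field_simps)
      finally show ?thesis by simp
    next
      case 3
      have "?dy \<le> 2 * ?dx" using d 3 by linarith
      then have "real n * ?dy \<le> real n * (2 * ?dx)" by (intro mult_left_mono) auto
      then have "2 \<le> real n * ?dx" using 3 by linarith
      then have "cutoff \<Omega> n x = 1" "cutoff \<Omega> n y = 1" using 3 by (auto simp: cutoff_def)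
      then show ?thesis using assms by simp
    qed
  qed
  ultimately show ?thesis by simp
qed

text \<open>The two terms come from the product rule for a cut-off times z, with the difference of
  cut-offs replaced by the bound of \<open>cutoff_diff_le\<close>. That bound is free of n, so one
  function dominates all n.\<close>

definition cutoff_majorant :: "real \<Rightarrow> real \<Rightarrow> 'a::euclidean_space set \<Rightarrow> ('a \<Rightarrow> real) \<Rightarrow> 'a \<times> 'a \<Rightarrow> real" where
  "cutoff_majorant s p \<Omega> z w = (\<bar>z (fst w) - z (snd w)\<bar> powr p +
     \<bar>z (snd w)\<bar> powr p * min 1 (4 * norm (fst w - snd w) / infdist (snd w) (- \<Omega>)) powr p)
     * riesz_kernel (s * p) w"

lemma borel_measurable_cutoff_majorant [measurable]:
  assumes [measurable]: "z \<in> borel_measurable lebesgue"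
  shows "cutoff_majorant s p \<Omega> z \<in> borel_measurable (lebesgue \<Otimes>\<^sub>M lebesgue)"
  unfolding cutoff_majorant_def [abs_def] by measurable

lemma cutoff_majorant_nonneg: "0 \<le> cutoff_majorant s p \<Omega> z w"
  by (simp add: cutoff_majorant_def)

lemma cutoff_mult_diff_le:
  fixes z :: "'a::euclidean_space \<Rightarrow> real"
  assumes "open \<Omega>" "bounded \<Omega>" "0 \<le> p" "\<And>x. x \<notin> \<Omega> \<Longrightarrow> z x = 0"
  shows "\<bar>cutoff \<Omega> n (fst w) * z (fst w) - cutoff \<Omega> n (snd w) * z (snd w)\<bar> powr p * riesz_kernel (s * p) w
    \<le> 2 powr p * cutoff_majorant s p \<Omega> z w"
proof -
  obtain x y where w: "w = (x, y)" by fastforce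
  let ?m = "min 1 (4 * norm (x - y) / infdist y (- \<Omega>))"
  have m: "0 \<le> ?m" by (simp add: infdist_nonneg)
  \<comment> \<open>For y outside \<Omega> the quotient in the bound has denominator 0, but z(y) = 0
    there.\<close>
  have "\<bar>z y\<bar> * \<bar>cutoff \<Omega> n x - cutoff \<Omega> n y\<bar> \<le> \<bar>z y\<bar> * ?m"
  proof (cases "y \<in> \<Omega>")
    case True
    then show ?thesis
      using infdist_Compl_pos_iff[OF assms(1,2), of y] by (intro mult_left_mono cutoff_diff_le) auto
  qed (use assms(4) in simp)
  moreover have "\<bar>cutoff \<Omega> n x * (z x - z y)\<bar> \<le> \<bar>z x - z y\<bar>"
    using cutoff_bounds[of \<Omega> n x] by (simp add: abs_mult mult_left_le_one_le)
  moreover have "cutoff \<Omega> n x * z x - cutoff \<Omega> n y * z y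
      = cutoff \<Omega> n x * (z x - z y) + z y * (cutoff \<Omega> n x - cutoff \<Omega> n y)"
    by (simp add: algebra_simps)
  ultimately have "\<bar>cutoff \<Omega> n x * z x - cutoff \<Omega> n y * z y\<bar> \<le> \<bar>z x - z y\<bar> + \<bar>z y\<bar> * ?m"
    using abs_triangle_ineq[of "cutoff \<Omega> n x * (z x - z y)" "z y * (cutoff \<Omega> n x - cutoff \<Omega> n y)"]
    by (simp add: abs_mult)
  then have "\<bar>cutoff \<Omega> n x * z x - cutoff \<Omega> n y * z y\<bar> powr p \<le> (\<bar>z x - z y\<bar> + \<bar>z y\<bar> * ?m) powr p"
    using assms(3) by (intro powr_mono2) auto
  also have "\<dots> \<le> 2 powr p * (\<bar>z x - z y\<bar> powr p + (\<bar>z y\<bar> * ?m) powr p)"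
    using m assms(3) by (intro powr_add_le) auto
  also have "(\<bar>z y\<bar> * ?m) powr p = \<bar>z y\<bar> powr p * ?m powr p"
    using m by (simp add: powr_mult)
  finally have "\<bar>cutoff \<Omega> n x * z x - cutoff \<Omega> n y * z y\<bar> powr p * riesz_kernel (s * p) w
    \<le> 2 powr p * (\<bar>z x - z y\<bar> powr p + \<bar>z y\<bar> powr p * ?m powr p) * riesz_kernel (s * p) w"
    by (rule mult_right_mono) simp
  then show ?thesis
    by (simp add: cutoff_majorant_def w mult.assoc)
qed

text \<open>The first term is the energy of z. In the second, integration over x turns the minimum
  and the kernel into a multiple of d(y)^(-sp), and the Hardy inequality bounds what is
  left.\<close>

lemma integrable_cutoff_majorant:
  fixes \<Omega> :: "'a::euclidean_space set"
  assumes "open \<Omega>" "bounded \<Omega>" "C11_boundary \<Omega>" "0 < s" "s < 1" "1 < p"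
    and z [measurable]: "z \<in> borel_measurable lebesgue" and z0: "\<And>x. x \<notin> \<Omega> \<Longrightarrow> z x = 0"
    and fin: "gagliardo s p UNIV z < \<infinity>"
  shows "integrable (lebesgue \<Otimes>\<^sub>M lebesgue) (cutoff_majorant s p \<Omega> z)"
proof (rule integrableI_nonneg)
  have sp: "0 < s * p" "s * p < p" using assms by auto
  obtain C where C: "0 \<le> C"
    "\<And>(y::'a) d. 0 < d \<Longrightarrow>
      (\<integral>\<^sup>+ x. ennreal (min 1 (4 * norm (x - y) / d) powr p * riesz_kernel (s * p) (x, y)) \<partial>lebesgue)
        \<le> ennreal (C * d powr (- (s * p)))"
    using that by (rule nn_integral_riesz_kernel_bound[OF sp])
  obtain H where "0 \<le> H" and H:
      "(\<integral>\<^sup>+ y. ennreal (\<bar>z y\<bar> powr p * infdist y (- \<Omega>) powr (- (s * p))) \<partial>lebesgue)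
        \<le> ennreal H * gagliardo s p UNIV z"
  proof (rule fractional_hardy[OF assms(1-3) sp(1)])
    fix H
    assume "0 \<le> H" "\<And>z. \<lbrakk>z \<in> borel_measurable lebesgue; \<And>x. x \<notin> \<Omega> \<Longrightarrow> z x = 0\<rbrakk> \<Longrightarrow>
      (\<integral>\<^sup>+ y. ennreal (\<bar>z y\<bar> powr p * infdist y (- \<Omega>) powr (- (s * p))) \<partial>lebesgue)
        \<le> ennreal H * gagliardo s p UNIV z"
    then show thesis using that z z0 by blast
  qed
  let ?f = "\<lambda>w. ennreal (\<bar>z (fst w) - z (snd w)\<bar> powr p * riesz_kernel (s * p) w)"
  let ?k = "\<lambda>w. min 1 (4 * norm (fst w - snd w) / infdist (snd w) (- \<Omega>)) powr p * riesz_kernel (s * p) w"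
  have "(\<integral>\<^sup>+ w. ennreal (cutoff_majorant s p \<Omega> z w) \<partial>(lebesgue \<Otimes>\<^sub>M lebesgue))
    = (\<integral>\<^sup>+ w. ?f w + ennreal (\<bar>z (snd w)\<bar> powr p) * ennreal (?k w) \<partial>(lebesgue \<Otimes>\<^sub>M lebesgue))"
    by (intro nn_integral_cong)
       (simp add: cutoff_majorant_def distrib_right mult.assoc flip: ennreal_mult' ennreal_plus)
  also have "\<dots> = gagliardo s p UNIV z
      + (\<integral>\<^sup>+ w. ennreal (\<bar>z (snd w)\<bar> powr p) * ennreal (?k w) \<partial>(lebesgue \<Otimes>\<^sub>M lebesgue))"
    by (subst nn_integral_add) (simp_all add: gagliardo_riesz_kernel)
  also have "(\<integral>\<^sup>+ w. ennreal (\<bar>z (snd w)\<bar> powr p) * ennreal (?k w) \<partial>(lebesgue \<Otimes>\<^sub>M lebesgue))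
      = (\<integral>\<^sup>+ y. (\<integral>\<^sup>+ x. ennreal (\<bar>z y\<bar> powr p) * ennreal (?k (x, y)) \<partial>lebesgue) \<partial>lebesgue)"
    by (subst lebesgue_pair.nn_integral_snd[symmetric]) simp_all
  also have "\<dots> \<le> (\<integral>\<^sup>+ y. ennreal C * ennreal (\<bar>z y\<bar> powr p * infdist y (- \<Omega>) powr (- (s * p))) \<partial>lebesgue)"
  proof (intro nn_integral_mono)
    fix y
    have k: "(\<lambda>x. ennreal (?k (x, y))) \<in> borel_measurable lebesgue" by measurable
    show "(\<integral>\<^sup>+ x. ennreal (\<bar>z y\<bar> powr p) * ennreal (?k (x, y)) \<partial>lebesgue)
       \<le> ennreal C * ennreal (\<bar>z y\<bar> powr p * infdist y (- \<Omega>) powr (- (s * p)))"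
    proof (cases "y \<in> \<Omega>")
      case True
      then have d: "0 < infdist y (- \<Omega>)" using infdist_Compl_pos_iff[OF assms(1,2)] by simp
      have "(\<integral>\<^sup>+ x. ennreal (\<bar>z y\<bar> powr p) * ennreal (?k (x, y)) \<partial>lebesgue)
          = ennreal (\<bar>z y\<bar> powr p) * (\<integral>\<^sup>+ x. ennreal (?k (x, y)) \<partial>lebesgue)"
        by (rule nn_integral_cmult[OF k])
      also have "\<dots> \<le> ennreal (\<bar>z y\<bar> powr p) * ennreal (C * infdist y (- \<Omega>) powr (- (s * p)))"
        using C(2)[OF d, of y] by (intro mult_left_mono) simp_all
      also have "\<dots> = ennreal C * ennreal (\<bar>z y\<bar> powr p * infdist y (- \<Omega>) powr (- (s * p)))"
        using C(1) by (simp add: ac_simps flip: ennreal_mult')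
      finally show ?thesis .
    qed (simp add: z0)
  qed
  also have "\<dots> = ennreal C * (\<integral>\<^sup>+ y. ennreal (\<bar>z y\<bar> powr p * infdist y (- \<Omega>) powr (- (s * p))) \<partial>lebesgue)"
    by (rule nn_integral_cmult) measurable
  also have "\<dots> \<le> ennreal C * (ennreal H * gagliardo s p UNIV z)"
    by (intro mult_left_mono H) simp
  also have "gagliardo s p UNIV z + ennreal C * (ennreal H * gagliardo s p UNIV z) < \<infinity>"
    using fin by (simp add: ennreal_mult_less_top)
  finally show "(\<integral>\<^sup>+ w. ennreal (cutoff_majorant s p \<Omega> z w) \<partial>(lebesgue \<Otimes>\<^sub>M lebesgue)) < \<infinity>"
    by (simp add: add_left_mono)
qed (use cutoff_majorant_nonneg in \<open>auto intro!: always_eventually\<close>)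

section \<open>Truncations and test functions\<close>

definition inner_region :: "'a::euclidean_space set \<Rightarrow> real \<Rightarrow> 'a set" where
  "inner_region \<Omega> r = {x. r < infdist x (- \<Omega>)}"

lemma open_inner_region: "open (inner_region \<Omega> r)"
  unfolding inner_region_def
  by (intro open_Collect_less continuous_on_infdist continuous_on_id continuous_on_const)

lemma inner_region_compactly_contained:
  fixes \<Omega> :: "'a::euclidean_space set"
  assumes "open \<Omega>" "bounded \<Omega>" "0 < r"
  shows "inner_region \<Omega> r \<Subset> \<Omega>"
proof -
  have "closed {x. r \<le> infdist x (- \<Omega>)}"
    by (intro closed_Collect_le continuous_on_infdist continuous_on_id continuous_on_const)
  moreover have "inner_region \<Omega> r \<subseteq> {x. r \<le> infdist x (- \<Omega>)}"
    by (auto simp: inner_region_def)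
  ultimately have cl: "closure (inner_region \<Omega> r) \<subseteq> {x. r \<le> infdist x (- \<Omega>)}"
    by (intro closure_minimal)
  also have "\<dots> \<subseteq> \<Omega>"
    using assms infdist_Compl_pos_iff[OF assms(1,2)] by (auto intro: less_le_trans)
  finally have sub: "closure (inner_region \<Omega> r) \<subseteq> \<Omega>" .
  then have "compact (closure (inner_region \<Omega> r))"
    using assms(2) bounded_subset compact_eq_bounded_closed by blast
  with sub show ?thesis by (simp add: compactly_contained_def)
qed

lemma UN_inner_region:
  fixes \<Omega> :: "'a::euclidean_space set"
  assumes "open \<Omega>" "bounded \<Omega>" "x \<in> \<Omega>"
  shows "\<exists>m. \<forall>n\<ge>m. x \<in> inner_region \<Omega> (1 / real (Suc n))"
proof -
  have d: "0 < infdist x (- \<Omega>)" using assms infdist_Compl_pos_iff by blast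
  then obtain m where m: "inverse (real (Suc m)) < infdist x (- \<Omega>)"
    using reals_Archimedean by blast
  have "1 / real (Suc n) < infdist x (- \<Omega>)" if "m \<le> n" for n
  proof -
    have "1 / real (Suc n) \<le> inverse (real (Suc m))" using that by (simp add: field_simps)
    then show ?thesis using m by simp
  qed
  then show ?thesis by (auto simp: inner_region_def)
qed

text \<open>\<open>Wsp_loc\<close> gives measurability only on compactly contained sets. As u
  vanishes outside \<Omega>, it is the pointwise limit of its restrictions to the inner
  regions.\<close>

lemma weak_solution_measurable:
  fixes \<Omega> :: "'a::euclidean_space set"
  assumes "open \<Omega>" "bounded \<Omega>" "weak_solution s p \<Omega> \<gamma> k u"
  shows "u \<in> borel_measurable lebesgue"
proof (rule borel_measurable_LIMSEQ_metric)
  fix n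
  let ?\<omega> = "inner_region \<Omega> (1 / real (Suc n))"
  have "?\<omega> \<Subset> \<Omega>"
    by (rule inner_region_compactly_contained[OF assms(1,2)]) simp
  then have "u \<in> Lp_on p ?\<omega>"
    using assms(3) open_inner_region[of \<Omega> "1 / real (Suc n)"]
    unfolding weak_solution_def Wsp_loc_def by blast
  then show "(\<lambda>x. indicator ?\<omega> x * u x) \<in> borel_measurable lebesgue"
    by (simp add: Lp_on_def set_borel_measurable_def)
next
  fix x
  show "(\<lambda>n. indicator (inner_region \<Omega> (1 / real (Suc n))) x * u x) \<longlonglongrightarrow> u x"
  proof (cases "x \<in> \<Omega>")
    case True
    then obtain m where m: "\<forall>n\<ge>m. x \<in> inner_region \<Omega> (1 / real (Suc n))"
      using UN_inner_region[OF assms(1,2)] by blast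
    show ?thesis
      by (rule tendsto_eventually, rule eventually_sequentiallyI[of m]) (use m in simp)
  next
    case False
    then have "u x = 0" using assms(3) by (simp add: weak_solution_def)
    then show ?thesis by simp
  qed
qed

lemma weak_solution_pos:
  fixes \<Omega> :: "'a::euclidean_space set"
  assumes "open \<Omega>" "bounded \<Omega>" "weak_solution s p \<Omega> \<gamma> k u"
  shows "AE x in lebesgue. x \<in> \<Omega> \<longrightarrow> 0 < u x"
proof -
  have "AE x in lebesgue. x \<in> inner_region \<Omega> (1 / real (Suc n)) \<longrightarrow> 0 < u x" for n
  proof -
    obtain c where "0 < c" "AE x in lebesgue. x \<in> inner_region \<Omega> (1 / real (Suc n)) \<longrightarrow> c \<le> u x"
      using assms(3) inner_region_compactly_contained[OF assms(1,2), of "1 / real (Suc n)"]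
      unfolding weak_solution_def by (simp del: of_nat_Suc) blast
    then show ?thesis by (auto elim: eventually_mono)
  qed
  then have "AE x in lebesgue. \<forall>n. x \<in> inner_region \<Omega> (1 / real (Suc n)) \<longrightarrow> 0 < u x"
    unfolding AE_all_countable by blast
  then show ?thesis
    by (rule eventually_mono) (use UN_inner_region[OF assms(1,2)] in blast)
qed

text \<open>Only a power of \<open>v\<close> is known to have finite energy, but \<open>(v - \<epsilon>)\<^sup>+\<close> is a Lipschitz function
  of that power.\<close>

lemma weak_solution_truncation:
  fixes \<Omega> :: "'a::euclidean_space set"
  assumes "open \<Omega>" "bounded \<Omega>" "1 < p" "weak_solution s p \<Omega> \<gamma> k v" "0 < \<epsilon>"
  defines "z \<equiv> (\<lambda>x. max 0 (v x - \<epsilon>))"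
  shows "gagliardo s p UNIV z < \<infinity>" "(\<integral>\<^sup>+ x. ennreal (\<bar>z x\<bar> powr p) \<partial>lebesgue) < \<infinity>"
proof -
  obtain \<kappa> where \<kappa>: "1 \<le> \<kappa>" and V: "(\<lambda>x. v x powr \<kappa>) \<in> Wsp s p"
    using assms(4) by (auto simp: weak_solution_def Wsp0_def)
  have [measurable]: "v \<in> borel_measurable lebesgue"
    using assms(1,2,4) by (rule weak_solution_measurable)
  define L where "L = \<epsilon> powr (1 - \<kappa>)"
  have L: "0 \<le> L" by (simp add: L_def)
  \<comment> \<open>Positivity holds only almost everywhere, while
    \<open>truncation_lipschitz\<close> needs nonnegative arguments; hence the pointwise bounds hold
    off a null set.\<close>
  have pos: "AE x in lebesgue. 0 \<le> v x"
  proof -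
    have "v x = 0" if "x \<notin> \<Omega>" for x using assms(4) that by (simp add: weak_solution_def)
    then show ?thesis
      using weak_solution_pos[OF assms(1,2,4)] by (auto elim!: eventually_mono)
  qed
  have bnd: "\<bar>z x - z y\<bar> powr p \<le> L powr p * \<bar>v x powr \<kappa> - v y powr \<kappa>\<bar> powr p"
    if "0 \<le> v x" "0 \<le> v y" for x y
  proof -
    have "\<bar>z x - z y\<bar> \<le> L * \<bar>v x powr \<kappa> - v y powr \<kappa>\<bar>"
      unfolding z_def L_def using that assms(5) \<kappa> by (rule truncation_lipschitz)
    then have "\<bar>z x - z y\<bar> powr p \<le> (L * \<bar>v x powr \<kappa> - v y powr \<kappa>\<bar>) powr p"
      using assms(3) by (intro powr_mono2) auto
    then show ?thesis using L by (simp add: powr_mult)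
  qed
  let ?V = "\<lambda>x. v x powr \<kappa>"
  let ?q = "\<lambda>w. ennreal (\<bar>?V (fst w) - ?V (snd w)\<bar> powr p * riesz_kernel (s * p) w)"
  have "gagliardo s p UNIV z
      \<le> (\<integral>\<^sup>+ w. ennreal (L powr p) * ?q w \<partial>(lebesgue \<Otimes>\<^sub>M lebesgue))"
    unfolding gagliardo_riesz_kernel
  proof (rule nn_integral_mono_AE)
    show "AE w in lebesgue \<Otimes>\<^sub>M lebesgue.
      ennreal (\<bar>z (fst w) - z (snd w)\<bar> powr p * riesz_kernel (s * p) w) * indicator (UNIV \<times> UNIV) w
       \<le> ennreal (L powr p) * ?q w"
      using AE_lebesgue_pair[OF pos]
    proof (rule eventually_mono)
      fix w :: "'a \<times> 'a"
      assume "0 \<le> v (fst w) \<and> 0 \<le> v (snd w)"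
      then have "\<bar>z (fst w) - z (snd w)\<bar> powr p * riesz_kernel (s * p) w
          \<le> L powr p * \<bar>?V (fst w) - ?V (snd w)\<bar> powr p * riesz_kernel (s * p) w"
        by (intro mult_right_mono bnd) auto
      then show "ennreal (\<bar>z (fst w) - z (snd w)\<bar> powr p * riesz_kernel (s * p) w) * indicator (UNIV \<times> UNIV) w
       \<le> ennreal (L powr p) * ?q w"
        by (simp add: mult.assoc ennreal_leI flip: ennreal_mult')
    qed
  qed
  also have "\<dots> = ennreal (L powr p) * gagliardo s p UNIV ?V"
    unfolding gagliardo_riesz_kernel by (subst nn_integral_cmult) simp_all
  also have "\<dots> < \<infinity>"
    using V by (simp add: Wsp_def ennreal_mult_less_top)
  finally show "gagliardo s p UNIV z < \<infinity>" .
  have "(\<integral>\<^sup>+ x. ennreal (\<bar>z x\<bar> powr p) \<partial>lebesgue)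
      \<le> (\<integral>\<^sup>+ x. ennreal (L powr p) * ennreal (\<bar>?V x\<bar> powr p) \<partial>lebesgue)"
  proof (rule nn_integral_mono_AE, use pos in \<open>rule eventually_mono\<close>)
    fix x assume x: "0 \<le> v x"
    have "\<bar>z x\<bar> \<le> L * \<bar>?V x\<bar>"
      using truncation_lipschitz[of "v x" 0 \<epsilon> \<kappa>] x assms(5) \<kappa> by (simp add: z_def L_def)
    then have "\<bar>z x\<bar> powr p \<le> (L * \<bar>?V x\<bar>) powr p"
      using assms(3) by (intro powr_mono2) auto
    then show "ennreal (\<bar>z x\<bar> powr p) \<le> ennreal (L powr p) * ennreal (\<bar>?V x\<bar> powr p)"
      using L by (simp add: powr_mult ennreal_leI flip: ennreal_mult')
  qed
  also have "\<dots> = ennreal (L powr p) * (\<integral>\<^sup>+ x. ennreal (\<bar>?V x\<bar> powr p) \<partial>lebesgue)"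
    by (rule nn_integral_cmult) measurable
  also have "\<dots> < \<infinity>"
  proof -
    have "integrable lebesgue (\<lambda>x. \<bar>?V x\<bar> powr p)"
      using V by (simp add: Wsp_def Lp_on_def set_integrable_def)
    then show ?thesis
      by (simp add: integrable_iff_bounded ennreal_mult_less_top)
  qed
  finally show "(\<integral>\<^sup>+ x. ennreal (\<bar>z x\<bar> powr p) \<partial>lebesgue) < \<infinity>" .
qed

text \<open>Outside \<omega>' \<times> \<omega>' only pairs with one point in \<omega> contribute,
  and their distance is at least \<rho>. There the kernel is integrable in one variable, so the L^p
  norm controls these pairs.\<close>

lemma gagliardo_UNIV_finite:
  fixes \<phi> :: "'a::euclidean_space \<Rightarrow> real"
  assumes "0 < s" "s < 1" "1 < p" "open \<omega>'" "0 < \<rho>"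
    and \<phi> [measurable]: "\<phi> \<in> borel_measurable lebesgue"
    and \<phi>0: "\<And>x. x \<notin> \<omega> \<Longrightarrow> \<phi> x = 0"
    and sep: "\<And>x y. \<lbrakk>x \<in> \<omega>; y \<notin> \<omega>'\<rbrakk> \<Longrightarrow> \<rho> \<le> norm (x - y)"
    and Lp: "(\<integral>\<^sup>+ x. ennreal (\<bar>\<phi> x\<bar> powr p) \<partial>lebesgue) < \<infinity>"
    and loc: "gagliardo s p \<omega>' \<phi> < \<infinity>"
  shows "gagliardo s p UNIV \<phi> < \<infinity>"
proof -
  have sp: "0 < s * p" "s * p < p" using assms by auto
  obtain C where C: "0 \<le> C"
    "\<And>(y::'a) d. 0 < d \<Longrightarrow>
      (\<integral>\<^sup>+ x. ennreal (min 1 (4 * norm (x - y) / d) powr p * riesz_kernel (s * p) (x, y)) \<partial>lebesgue)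
        \<le> ennreal (C * d powr (- (s * p)))"
    using that by (rule nn_integral_riesz_kernel_bound[OF sp])
  let ?M = "(lebesgue :: 'a measure) \<Otimes>\<^sub>M (lebesgue :: 'a measure)"
  let ?q = "\<lambda>w. ennreal (\<bar>\<phi> (fst w) - \<phi> (snd w)\<bar> powr p * riesz_kernel (s * p) w)"
  \<comment> \<open>With parameter 4 \<rho> the minimum is 1 at distances of at least \<rho>, so
    \<open>?k\<close> is the true kernel there and still has a finite integral.\<close>
  let ?k = "\<lambda>w. ennreal (min 1 (4 * norm (fst w - snd w) / (4 * \<rho>)) powr p * riesz_kernel (s * p) w)"
  let ?a = "\<lambda>x. ennreal (\<bar>\<phi> x\<bar> powr p)"
  have [measurable]: "\<omega>' \<in> sets lebesgue" using assms(4) by simp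
  have far: "ennreal (riesz_kernel (s * p) (x, y)) = ?k (x, y)" if "\<rho> \<le> norm (x - y)" for x y :: 'a
  proof -
    have "1 \<le> 4 * norm (x - y) / (4 * \<rho>)" using that assms(5) by simp
    then show ?thesis by (simp add: min_absorb1)
  qed
  have "?q (x, y) \<le> ?q (x, y) * indicator (\<omega>' \<times> \<omega>') (x, y) + (?a x * ?k (x, y) + ?a y * ?k (x, y))" for x y
  proof -
    \<comment> \<open>The last two cases are impossible: the separation, applied to a point and
      itself, forces \<omega> to lie in \<omega>'.\<close>
    consider "x \<in> \<omega>'" "y \<in> \<omega>'" | "x \<notin> \<omega>" "y \<notin> \<omega>" | "x \<notin> \<omega>" "y \<in> \<omega>" "x \<notin> \<omega>'"
      | "x \<in> \<omega>" "y \<notin> \<omega>'" "y \<notin> \<omega>" | "x \<in> \<omega>" "x \<notin> \<omega>'" | "y \<in> \<omega>" "y \<notin> \<omega>'"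
      by blast
    then show ?thesis
    proof cases
      case 1
      then show ?thesis by simp
    next
      case 2
      then show ?thesis using \<phi>0 by simp
    next
      case 3
      have "\<rho> \<le> norm (x - y)" using sep[OF 3(2,3)] by (simp add: norm_minus_commute)
      then have "?k (x, y) = ennreal (riesz_kernel (s * p) (x, y))"
        by (rule far[symmetric])
      moreover have "?q (x, y) = ?a y * ennreal (riesz_kernel (s * p) (x, y))"
        using \<phi>0[OF 3(1)] by (simp add: ennreal_mult')
      ultimately have "?q (x, y) = ?a y * ?k (x, y)" by (simp only:)
      then show ?thesis by (simp add: add_increasing)
    next
      case 4
      have "\<rho> \<le> norm (x - y)" using sep[OF 4(1,2)] .
      then have "?k (x, y) = ennreal (riesz_kernel (s * p) (x, y))"
        by (rule far[symmetric])
      moreover have "?q (x, y) = ?a x * ennreal (riesz_kernel (s * p) (x, y))"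
        using \<phi>0[OF 4(3)] by (simp add: ennreal_mult')
      ultimately have "?q (x, y) = ?a x * ?k (x, y)" by (simp only:)
      then show ?thesis by (simp add: add_increasing add_increasing2)
    next
      case 5
      then show ?thesis using sep[of x x] assms(5) by simp
    next
      case 6
      then show ?thesis using sep[of y y] assms(5) by simp
    qed
  qed
  then have "gagliardo s p UNIV \<phi> \<le>
      (\<integral>\<^sup>+ w. ?q w * indicator (\<omega>' \<times> \<omega>') w + (?a (fst w) * ?k w + ?a (snd w) * ?k w) \<partial>?M)"
    unfolding gagliardo_riesz_kernel by (intro nn_integral_mono) (simp add: split_paired_all)
  also have "\<dots> = gagliardo s p \<omega>' \<phi>
      + ((\<integral>\<^sup>+ w. ?a (fst w) * ?k w \<partial>?M) + (\<integral>\<^sup>+ w. ?a (snd w) * ?k w \<partial>?M))"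
  proof -
    have m: "(\<lambda>w. ?q w * indicator (\<omega>' \<times> \<omega>') w) \<in> borel_measurable ?M"
      "(\<lambda>w. ?a (fst w) * ?k w) \<in> borel_measurable ?M"
      "(\<lambda>w. ?a (snd w) * ?k w) \<in> borel_measurable ?M"
      by measurable
    show ?thesis
      unfolding gagliardo_riesz_kernel nn_integral_add[OF m(2,3), symmetric]
      by (rule nn_integral_add[OF m(1) borel_measurable_add[OF m(2,3)]])
  qed
  also have "\<dots> < \<infinity>"
  proof -
    define B where "B = ennreal (C * (4 * \<rho>) powr (- (s * p)))"
    have inner: "(\<integral>\<^sup>+ x. ?a y * ?k (x, y) \<partial>lebesgue) \<le> B * ?a y" for y
    proof -
      have "(\<lambda>x. ?k (x, y)) \<in> borel_measurable lebesgue" by measurable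
      then have "(\<integral>\<^sup>+ x. ?a y * ?k (x, y) \<partial>lebesgue) = ?a y * (\<integral>\<^sup>+ x. ?k (x, y) \<partial>lebesgue)"
        by (rule nn_integral_cmult)
      also have "\<dots> \<le> ?a y * B"
        unfolding B_def using C(2)[of "4 * \<rho>" y] assms(5) by (intro mult_left_mono) simp_all
      finally show ?thesis by (simp add: mult.commute)
    qed
    have outer: "(\<integral>\<^sup>+ y. \<integral>\<^sup>+ x. ?a y * ?k (x, y) \<partial>lebesgue \<partial>lebesgue) < \<infinity>"
    proof -
      have "(\<integral>\<^sup>+ y. \<integral>\<^sup>+ x. ?a y * ?k (x, y) \<partial>lebesgue \<partial>lebesgue) \<le> (\<integral>\<^sup>+ y. B * ?a y \<partial>lebesgue)"
        by (intro nn_integral_mono inner)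
      also have "\<dots> = B * (\<integral>\<^sup>+ y. ?a y \<partial>lebesgue)"
        by (rule nn_integral_cmult) measurable
      also have "\<dots> < \<infinity>" using Lp by (simp add: B_def ennreal_mult_less_top)
      finally show ?thesis .
    qed
    have "(\<integral>\<^sup>+ w. ?a (fst w) * ?k w \<partial>?M) = (\<integral>\<^sup>+ x. \<integral>\<^sup>+ y. ?a x * ?k (x, y) \<partial>lebesgue \<partial>lebesgue)"
      by (subst lebesgue.nn_integral_fst[symmetric]) simp_all
    also have "\<dots> = (\<integral>\<^sup>+ y. \<integral>\<^sup>+ x. ?a y * ?k (x, y) \<partial>lebesgue \<partial>lebesgue)"
    proof -
      have k_sym: "?k (x, y) = ?k (y, x)" for x y
        unfolding riesz_kernel_commute[of _ x] by (simp add: norm_minus_commute)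
      show ?thesis
        by (intro nn_integral_cong arg_cong2[where f = "(*)"] refl k_sym)
    qed
    finally have "(\<integral>\<^sup>+ w. ?a (fst w) * ?k w \<partial>?M) < \<infinity>"
      using outer by simp
    moreover have "(\<integral>\<^sup>+ w. ?a (snd w) * ?k w \<partial>?M) < \<infinity>"
      using outer by (subst lebesgue_pair.nn_integral_snd[symmetric]) simp_all
    ultimately show ?thesis using loc by simp
  qed
  finally show ?thesis .
qed

text \<open>The inner maximum makes the function vanish everywhere outside the support of \<open>w\<close>, although
  a weak solution \<open>u\<close> may be negative on a null set.\<close>

lemma positive_part_test_function:
  fixes \<Omega> :: "'a::euclidean_space set"
  assumes "open \<Omega>" "bounded \<Omega>" "0 < s" "s < 1" "1 < p" "0 < r"
    and w [measurable]: "w \<in> borel_measurable lebesgue" and w0: "\<And>x. 0 \<le> w x"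
    and supp: "\<And>x. x \<notin> inner_region \<Omega> r \<Longrightarrow> w x = 0"
    and Lp: "(\<integral>\<^sup>+ x. ennreal (\<bar>w x\<bar> powr p) \<partial>lebesgue) < \<infinity>"
    and fin: "gagliardo s p UNIV w < \<infinity>"
    and u [measurable]: "u \<in> borel_measurable lebesgue" and loc: "u \<in> Wsp_loc s p \<Omega>"
  shows "(\<lambda>x. max 0 (w x - max 0 (u x))) \<in> test_functions s p \<Omega>"
proof -
  define \<phi> where "\<phi> x = max 0 (w x - max 0 (u x))" for x
  \<comment> \<open>Halving r leaves a margin r/2 around the support, because the distance function
    is 1-Lipschitz, and u still has finite energy on the larger region.\<close>
  let ?\<omega> = "inner_region \<Omega> r" and ?\<omega>' = "inner_region \<Omega> (r / 2)"
  have [measurable]: "\<phi> \<in> borel_measurable lebesgue" unfolding \<phi>_def [abs_def] by measurable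
  have [measurable]: "?\<omega>' \<in> sets lebesgue" using open_inner_region[of \<Omega> "r / 2"] by simp
  have \<phi>0: "\<phi> x = 0" if "x \<notin> ?\<omega>" for x
    using supp[OF that] by (simp add: \<phi>_def)
  have \<phi>w: "\<bar>\<phi> x\<bar> powr p \<le> \<bar>w x\<bar> powr p" for x
    using w0[of x] assms(5) by (intro powr_mono2) (auto simp: \<phi>_def)
  have \<phi>Lp: "(\<integral>\<^sup>+ x. ennreal (\<bar>\<phi> x\<bar> powr p) \<partial>lebesgue) < \<infinity>"
    by (rule le_less_trans[OF nn_integral_mono Lp]) (intro ennreal_leI \<phi>w)
  have "?\<omega>' \<Subset> \<Omega>" using assms by (intro inner_region_compactly_contained) auto
  then have uloc: "gagliardo s p ?\<omega>' u < \<infinity>"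
    using loc open_inner_region[of \<Omega> "r / 2"] unfolding Wsp_loc_def by blast
  let ?q = "\<lambda>f w. ennreal (\<bar>f (fst w) - f (snd w)\<bar> powr p * riesz_kernel (s * p) w)"
  have bnd: "?q \<phi> z \<le> ennreal (2 powr p) * (?q w z + ?q u z)" for z
  proof -
    have "\<bar>\<phi> (fst z) - \<phi> (snd z)\<bar> \<le> \<bar>w (fst z) - w (snd z)\<bar> + \<bar>u (fst z) - u (snd z)\<bar>"
      unfolding \<phi>_def by linarith
    then have "\<bar>\<phi> (fst z) - \<phi> (snd z)\<bar> powr p
        \<le> (\<bar>w (fst z) - w (snd z)\<bar> + \<bar>u (fst z) - u (snd z)\<bar>) powr p"
      using assms(5) by (intro powr_mono2) auto
    also have "\<dots> \<le> 2 powr p * (\<bar>w (fst z) - w (snd z)\<bar> powr p + \<bar>u (fst z) - u (snd z)\<bar> powr p)"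
      using assms(5) by (intro powr_add_le) auto
    finally have "\<bar>\<phi> (fst z) - \<phi> (snd z)\<bar> powr p * riesz_kernel (s * p) z
      \<le> 2 powr p * (\<bar>w (fst z) - w (snd z)\<bar> powr p + \<bar>u (fst z) - u (snd z)\<bar> powr p)
          * riesz_kernel (s * p) z"
      by (rule mult_right_mono) simp
    then have "?q \<phi> z \<le> ennreal (2 powr p * (\<bar>w (fst z) - w (snd z)\<bar> powr p * riesz_kernel (s * p) z
        + \<bar>u (fst z) - u (snd z)\<bar> powr p * riesz_kernel (s * p) z))"
      by (intro ennreal_leI) (simp add: algebra_simps)
    also have "\<dots> = ennreal (2 powr p) * (?q w z + ?q u z)"
      by (subst ennreal_mult', simp, subst ennreal_plus) simp_all
    finally show ?thesis .
  qed
  have "gagliardo s p ?\<omega>' \<phi> \<le> (\<integral>\<^sup>+ z. ennreal (2 powr p) * (?q w z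
      + ?q u z * indicator (?\<omega>' \<times> ?\<omega>') z) \<partial>(lebesgue \<Otimes>\<^sub>M lebesgue))"
    unfolding gagliardo_riesz_kernel
  proof (intro nn_integral_mono)
    fix z :: "'a \<times> 'a"
    show "?q \<phi> z * indicator (?\<omega>' \<times> ?\<omega>') z
      \<le> ennreal (2 powr p) * (?q w z + ?q u z * indicator (?\<omega>' \<times> ?\<omega>') z)"
      using bnd[of z] by (cases "z \<in> ?\<omega>' \<times> ?\<omega>'") simp_all
  qed
  also have "\<dots> = ennreal (2 powr p) * (gagliardo s p UNIV w + gagliardo s p ?\<omega>' u)"
  proof -
    have m: "?q w \<in> borel_measurable (lebesgue \<Otimes>\<^sub>M lebesgue)"
      "(\<lambda>z. ?q u z * indicator (?\<omega>' \<times> ?\<omega>') z) \<in> borel_measurable (lebesgue \<Otimes>\<^sub>M lebesgue)"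
      by measurable
    have "gagliardo s p UNIV w = (\<integral>\<^sup>+ z. ?q w z \<partial>(lebesgue \<Otimes>\<^sub>M lebesgue))"
      by (simp add: gagliardo_riesz_kernel)
    then show ?thesis
      unfolding gagliardo_riesz_kernel[of s p ?\<omega>'] by (simp only: nn_integral_add[OF m, symmetric])
        (rule nn_integral_cmult[OF borel_measurable_add[OF m]])
  qed
  also have "\<dots> < \<infinity>" using fin uloc by (simp add: ennreal_mult_less_top)
  finally have "gagliardo s p ?\<omega>' \<phi> < \<infinity>" .
  moreover have "r / 2 \<le> norm (x - y)" if "x \<in> ?\<omega>" "y \<notin> ?\<omega>'" for x y
    using that infdist_triangle_abs[of x "- \<Omega>" y] by (simp add: inner_region_def dist_norm)
  ultimately have "gagliardo s p UNIV \<phi> < \<infinity>"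
    using assms(3-6) \<phi>0 \<phi>Lp open_inner_region[of \<Omega> "r / 2"]
    by (intro gagliardo_UNIV_finite[of s p ?\<omega>' "r / 2" \<phi> ?\<omega>]) auto
  moreover have "\<phi> \<in> Lp_on p UNIV"
    using \<phi>Lp by (simp add: Lp_on_def set_borel_measurable_def set_integrable_def integrable_iff_bounded)
  ultimately have "\<phi> \<in> Wsp0 s p ?\<omega>"
    using \<phi>0 by (simp add: Wsp0_def Wsp_def)
  moreover have "?\<omega> \<Subset> \<Omega>" using assms by (intro inner_region_compactly_contained) auto
  ultimately show ?thesis
    unfolding test_functions_def \<phi>_def [abs_def, symmetric] using open_inner_region by blast
qed

section \<open>Comparison of weak solutions\<close>

text \<open>Dominated convergence for the flux mismatch produced by
  \<open>pointwise_monotonicity\<close>. With the dual exponent,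
  |\<open>signed_pow p t\<close>|^(p/(p-1)) is |t|^p, so a multiple of
  \<open>cutoff_majorant\<close> dominates every term.\<close>

lemma signed_pow_cutoff_energy_tendsto:
  fixes \<Omega> :: "'a::euclidean_space set"
  assumes "open \<Omega>" "bounded \<Omega>" "C11_boundary \<Omega>" "0 < s" "s < 1" "1 < p"
    and z [measurable]: "z \<in> borel_measurable lebesgue" and z0: "\<And>x. x \<notin> \<Omega> \<Longrightarrow> z x = 0"
    and fin: "gagliardo s p UNIV z < \<infinity>"
  defines "D \<equiv> (\<lambda>n w. \<bar>signed_pow p (z (fst w) - z (snd w))
      - signed_pow p (cutoff \<Omega> n (fst w) * z (fst w) - cutoff \<Omega> n (snd w) * z (snd w))\<bar>
        powr (p / (p - 1)) * riesz_kernel (s * p) w)"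
  shows "integrable (lebesgue \<Otimes>\<^sub>M lebesgue) (D n)"
    and "(\<lambda>n. LINT w|(lebesgue \<Otimes>\<^sub>M lebesgue). D n w) \<longlonglongrightarrow> 0"
proof -
  let ?M = "(lebesgue :: 'a measure) \<Otimes>\<^sub>M (lebesgue :: 'a measure)"
  let ?p' = "p / (p - 1)"
  let ?B = "\<lambda>w. 2 powr ?p' * (1 + 2 powr p) * cutoff_majorant s p \<Omega> z w"
  have p': "0 < ?p'" using assms(6) by simp
  have sp: "\<bar>signed_pow p t\<bar> powr ?p' = \<bar>t\<bar> powr p" for t
    using assms(6) by (simp add: abs_signed_pow powr_powr)
  have [measurable]: "D n \<in> borel_measurable ?M" for n
    unfolding D_def by measurable
  have maj: "integrable ?M (cutoff_majorant s p \<Omega> z)"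
    using assms(1-6) z z0 fin by (rule integrable_cutoff_majorant)
  have bound: "norm (D n w) \<le> ?B w" for n w
  proof -
    let ?a = "z (fst w) - z (snd w)"
    let ?b = "cutoff \<Omega> n (fst w) * z (fst w) - cutoff \<Omega> n (snd w) * z (snd w)"
    let ?G = "cutoff_majorant s p \<Omega> z w" and ?k = "riesz_kernel (s * p) w"
    have "\<bar>signed_pow p ?a - signed_pow p ?b\<bar> powr ?p' \<le> 2 powr ?p' * (\<bar>?a\<bar> powr p + \<bar>?b\<bar> powr p)"
      using powr_diff_le[of ?p' "signed_pow p ?a" "signed_pow p ?b"] p' unfolding sp by simp
    then have "D n w \<le> 2 powr ?p' * (\<bar>?a\<bar> powr p + \<bar>?b\<bar> powr p) * ?k"
      unfolding D_def by (rule mult_right_mono) simp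
    also have "\<dots> = 2 powr ?p' * (\<bar>?a\<bar> powr p * ?k + \<bar>?b\<bar> powr p * ?k)"
      by (simp add: algebra_simps)
    also have "\<dots> \<le> 2 powr ?p' * (?G + 2 powr p * ?G)"
    proof (intro mult_left_mono add_mono)
      show "\<bar>?b\<bar> powr p * ?k \<le> 2 powr p * ?G"
        using assms(6) by (intro cutoff_mult_diff_le[OF assms(1,2) _ z0]) simp
      show "\<bar>?a\<bar> powr p * ?k \<le> ?G"
        unfolding cutoff_majorant_def by (intro mult_right_mono) simp_all
    qed simp
    finally show ?thesis by (simp add: D_def algebra_simps)
  qed
  have lim: "(\<lambda>n. D n w) \<longlonglongrightarrow> 0" for w
  proof -
    have c: "(\<lambda>n. cutoff \<Omega> n x * z x) \<longlonglongrightarrow> z x" for x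
    proof (cases "x \<in> \<Omega>")
      case True
      then have "(\<lambda>n. cutoff \<Omega> n x) \<longlonglongrightarrow> 1"
        using infdist_Compl_pos_iff[OF assms(1,2)] by (intro cutoff_tendsto) simp
      then have "(\<lambda>n. cutoff \<Omega> n x * z x) \<longlonglongrightarrow> 1 * z x" by (intro tendsto_intros)
      then show ?thesis by simp
    qed (simp add: z0)
    let ?a = "z (fst w) - z (snd w)"
    let ?b = "\<lambda>n. cutoff \<Omega> n (fst w) * z (fst w) - cutoff \<Omega> n (snd w) * z (snd w)"
    have "(\<lambda>n. signed_pow p (?b n)) \<longlonglongrightarrow> signed_pow p ?a"
      by (intro isCont_tendsto_compose[OF isCont_signed_pow[OF assms(6)]] tendsto_diff c)
    then have "(\<lambda>n. \<bar>signed_pow p ?a - signed_pow p (?b n)\<bar>) \<longlonglongrightarrow> \<bar>signed_pow p ?a - signed_pow p ?a\<bar>"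
      by (intro tendsto_intros)
    then have lim0: "(\<lambda>n. \<bar>signed_pow p ?a - signed_pow p (?b n)\<bar>) \<longlonglongrightarrow> 0" by simp
    have "(\<lambda>n. \<bar>signed_pow p ?a - signed_pow p (?b n)\<bar> powr ?p') \<longlonglongrightarrow> 0 powr ?p'"
      by (rule tendsto_powr'[OF lim0 tendsto_const]) (use p' in auto)
    then have "(\<lambda>n. \<bar>signed_pow p ?a - signed_pow p (?b n)\<bar> powr ?p' * riesz_kernel (s * p) w)
        \<longlonglongrightarrow> 0 powr ?p' * riesz_kernel (s * p) w"
      by (rule tendsto_mult[OF _ tendsto_const])
    then show ?thesis by (simp add: D_def)
  qed
  have B: "integrable ?M ?B" using maj by (rule integrable_mult_right)
  show "integrable ?M (D n)"
    by (rule Bochner_Integration.integrable_bound[OF B])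
       (use order_trans[OF bound abs_ge_self] in \<open>auto intro!: always_eventually\<close>)
  have "(\<lambda>n. integral\<^sup>L ?M (D n)) \<longlonglongrightarrow> integral\<^sup>L ?M (\<lambda>_. 0 :: real)"
  proof (rule integral_dominated_convergence[where M = ?M and s = D and f = "\<lambda>_. 0" and w = ?B])
    show "integrable ?M ?B" by (rule B)
    show "AE w in ?M. (\<lambda>n. D n w) \<longlonglongrightarrow> 0" using lim by (intro always_eventually allI)
    show "AE w in ?M. norm (D n w) \<le> ?B w" for n using bound by (intro always_eventually allI)
  qed simp_all
  then show "(\<lambda>n. LINT w|?M. D n w) \<longlonglongrightarrow> 0" by simp
qed

lemma weak_integrand_riesz_kernel:
  "weak_integrand s p u \<phi> w
    = signed_pow p (u (fst w) - u (snd w)) * (\<phi> (fst w) - \<phi> (snd w)) * riesz_kernel (s * p) w"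
  by (simp add: weak_integrand_def riesz_kernel_def case_prod_beta)

text \<open>Where the test function is positive, 0 < a < w \<le> b - \<epsilon>, so a < b; and
  t^(-\<gamma>) is decreasing.\<close>

lemma singular_term_nonneg:
  fixes k \<gamma> a b \<epsilon> w :: real
  assumes "0 < \<gamma>" "0 \<le> k" "0 < a" "0 < b" "0 \<le> \<epsilon>" "w \<le> max 0 (b - \<epsilon>)"
  shows "0 \<le> k / a powr \<gamma> - k / b powr \<gamma> \<or> max 0 (w - max 0 a) = 0"
proof (cases "w \<le> a")
  case False
  then have "a \<le> b" using assms by linarith
  then have "a powr \<gamma> \<le> b powr \<gamma>" using assms by (intro powr_mono2) auto
  then have "k / b powr \<gamma> \<le> k / a powr \<gamma>" using assms by (intro divide_left_mono) auto
  then show ?thesis by simp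
qed (use assms in simp)

lemma weak_solution_le_add:
  fixes \<Omega> :: "'a::euclidean_space set"
  assumes "open \<Omega>" "bounded \<Omega>" "C11_boundary \<Omega>" "0 < s" "s < 1" "1 < p" "0 < \<gamma>"
    and k: "\<And>x. x \<in> \<Omega> \<Longrightarrow> 0 < k x"
    and u: "weak_solution s p \<Omega> \<gamma> k u" and v: "weak_solution s p \<Omega> \<gamma> k v" and "0 < \<epsilon>"
  shows "AE x in lebesgue. x \<in> \<Omega> \<longrightarrow> v x \<le> u x + \<epsilon>"
proof -
  let ?M = "(lebesgue :: 'a measure) \<Otimes>\<^sub>M (lebesgue :: 'a measure)"
  note [measurable] = weak_solution_measurable[OF assms(1,2) u] weak_solution_measurable[OF assms(1,2) v]
  have vanish: "u x = 0" "v x = 0" if "x \<notin> \<Omega>" for x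
    using u v that by (simp_all add: weak_solution_def)
  have posu: "AE x in lebesgue. x \<in> \<Omega> \<longrightarrow> 0 < u x" and posv: "AE x in lebesgue. x \<in> \<Omega> \<longrightarrow> 0 < v x"
    using weak_solution_pos[OF assms(1,2) u] weak_solution_pos[OF assms(1,2) v] .
  have posu': "AE x in lebesgue. 0 \<le> u x"
    using posu vanish by (auto elim!: eventually_mono)
  define z where "z x = max 0 (v x - \<epsilon>)" for x
  define w where "w n x = cutoff \<Omega> n x * z x" for n x
  define \<phi> where "\<phi> n x = max 0 (w n x - max 0 (u x))" for n x
  have [measurable]: "z \<in> borel_measurable lebesgue" unfolding z_def [abs_def] by measurable
  have [measurable]: "w n \<in> borel_measurable lebesgue" for n unfolding w_def [abs_def] by measurable
  have z0: "0 \<le> z x" "x \<notin> \<Omega> \<Longrightarrow> z x = 0" for x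
    using vanish(2) assms(11) by (simp_all add: z_def)
  have w0: "0 \<le> w n x" "w n x \<le> z x" for n x
    using z0 cutoff_bounds[of \<Omega> n x] by (simp_all add: w_def mult_left_le_one_le)
  have zfin: "gagliardo s p UNIV z < \<infinity>" and zLp: "(\<integral>\<^sup>+ x. ennreal (\<bar>z x\<bar> powr p) \<partial>lebesgue) < \<infinity>"
    using weak_solution_truncation[OF assms(1,2,6) v assms(11)] by (simp_all add: z_def [abs_def])
  define G where "G = cutoff_majorant s p \<Omega> z"
  have G: "integrable ?M G"
    unfolding G_def by (rule integrable_cutoff_majorant) (use assms z0 zfin in auto)
  have wG: "\<bar>w n (fst y) - w n (snd y)\<bar> powr p * riesz_kernel (s * p) y \<le> 2 powr p * G y" for n y
    unfolding w_def G_def using assms(6) z0 by (intro cutoff_mult_diff_le[OF assms(1,2)]) auto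
  have wfin: "gagliardo s p UNIV (w n) < \<infinity>" for n
  proof -
    have "gagliardo s p UNIV (w n) \<le> (\<integral>\<^sup>+ y. ennreal (2 powr p * G y) \<partial>?M)"
      unfolding gagliardo_riesz_kernel by (intro nn_integral_mono) (simp add: wG ennreal_leI)
    also have "\<dots> = ennreal (LINT y|?M. 2 powr p * G y)"
      by (rule nn_integral_eq_integral)
        (use G cutoff_majorant_nonneg[of s p \<Omega> z] in \<open>auto simp: G_def intro!: always_eventually\<close>)
    finally show ?thesis by (simp add: le_less_trans)
  qed
  have wLp: "(\<integral>\<^sup>+ x. ennreal (\<bar>w n x\<bar> powr p) \<partial>lebesgue) < \<infinity>" for n
  proof (rule le_less_trans[OF nn_integral_mono zLp])
    show "ennreal (\<bar>w n x\<bar> powr p) \<le> ennreal (\<bar>z x\<bar> powr p)" for x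
      using w0[of n x] assms(6) by (intro ennreal_leI powr_mono2) auto
  qed
  have test: "\<phi> n \<in> test_functions s p \<Omega>" for n
    unfolding \<phi>_def [abs_def]
  proof (rule positive_part_test_function)
    \<comment> \<open>\<open>Suc n\<close> avoids the division by 0 at n = 0, where the cut-off
      vanishes anyway.\<close>
    show "0 < 1 / real (Suc n)" by simp
    show "w n x = 0" if "x \<notin> inner_region \<Omega> (1 / real (Suc n))" for x
    proof (rule ccontr)
      assume "w n x \<noteq> 0"
      then have "1 < real n * infdist x (- \<Omega>)"
        using cutoff_support by (auto simp: w_def)
      then have "1 < real (Suc n) * infdist x (- \<Omega>)"
        using infdist_nonneg[of x "- \<Omega>"] by (simp add: distrib_right)
      then show False
        using that by (simp add: inner_region_def field_simps)
    qed
    show "u \<in> Wsp_loc s p \<Omega>" using u by (simp add: weak_solution_def)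
  qed (use assms w0 wLp wfin in auto)

  \<comment> \<open>The difference of the two right-hand integrands; by the two equations its
    integral is that of the difference of the nonlocal terms.\<close>
  define F where "F n x = indicator \<Omega> x * ((k x / u x powr \<gamma> - k x / v x powr \<gamma>) * \<phi> n x)" for n x
  have F_int: "integrable lebesgue (F n)"
    and F_eq: "(LINT x|lebesgue. F n x)
      = (LINT y|?M. weak_integrand s p u (\<phi> n) y - weak_integrand s p v (\<phi> n) y)"
    and W_int: "integrable ?M (\<lambda>y. weak_integrand s p u (\<phi> n) y - weak_integrand s p v (\<phi> n) y)" for n
  proof -
    have U: "integrable ?M (weak_integrand s p u (\<phi> n))"
      "set_integrable lebesgue \<Omega> (\<lambda>x. k x / u x powr \<gamma> * \<phi> n x)"
      "(LINT y|?M. weak_integrand s p u (\<phi> n) y) = (LINT x:\<Omega>|lebesgue. k x / u x powr \<gamma> * \<phi> n x)"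
      using u test[of n] unfolding weak_solution_def by blast+
    have V: "integrable ?M (weak_integrand s p v (\<phi> n))"
      "set_integrable lebesgue \<Omega> (\<lambda>x. k x / v x powr \<gamma> * \<phi> n x)"
      "(LINT y|?M. weak_integrand s p v (\<phi> n) y) = (LINT x:\<Omega>|lebesgue. k x / v x powr \<gamma> * \<phi> n x)"
      using v test[of n] unfolding weak_solution_def by blast+
    have F: "F n = (\<lambda>x. indicator \<Omega> x *\<^sub>R (k x / u x powr \<gamma> * \<phi> n x)
        - indicator \<Omega> x *\<^sub>R (k x / v x powr \<gamma> * \<phi> n x))"
      by (auto simp: F_def fun_eq_iff algebra_simps)
    show "integrable lebesgue (F n)"
      unfolding F using U(2) V(2) unfolding set_integrable_def
      by (rule Bochner_Integration.integrable_diff)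
    show "integrable ?M (\<lambda>y. weak_integrand s p u (\<phi> n) y - weak_integrand s p v (\<phi> n) y)"
      using U(1) V(1) by (rule Bochner_Integration.integrable_diff)
    have "(LINT x|lebesgue. F n x) = (LINT x:\<Omega>|lebesgue. k x / u x powr \<gamma> * \<phi> n x)
        - (LINT x:\<Omega>|lebesgue. k x / v x powr \<gamma> * \<phi> n x)"
      using U(2) V(2) unfolding F set_integrable_def set_lebesgue_integral_def
      by (rule Bochner_Integration.integral_diff)
    also have "\<dots> = (LINT y|?M. weak_integrand s p u (\<phi> n) y - weak_integrand s p v (\<phi> n) y)"
      unfolding U(3)[symmetric] V(3)[symmetric] using U(1) V(1)
      by (rule Bochner_Integration.integral_diff[symmetric])
    finally show "(LINT x|lebesgue. F n x)
      = (LINT y|?M. weak_integrand s p u (\<phi> n) y - weak_integrand s p v (\<phi> n) y)" .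
  qed

  define D where "D n y = \<bar>signed_pow p (z (fst y) - z (snd y)) - signed_pow p (w n (fst y) - w n (snd y))\<bar>
        powr (p / (p - 1)) * riesz_kernel (s * p) y" for n y
  have D_int: "integrable ?M (D n)" and D_lim: "(\<lambda>n. LINT y|?M. D n y) \<longlonglongrightarrow> 0" for n
    using signed_pow_cutoff_energy_tendsto[OF assms(1-6) _ z0(2) zfin]
    by (simp_all add: D_def [abs_def] w_def)

  have F_nonneg: "AE x in lebesgue. 0 \<le> F m x \<and> (\<forall>n\<ge>m. F m x \<le> F n x)" for m
    using posu posv
  proof eventually_elim
    fix x assume x: "x \<in> \<Omega> \<longrightarrow> 0 < u x" "x \<in> \<Omega> \<longrightarrow> 0 < v x"
    show "0 \<le> F m x \<and> (\<forall>n\<ge>m. F m x \<le> F n x)"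
    proof (cases "x \<in> \<Omega>")
      case True
      let ?c = "k x / u x powr \<gamma> - k x / v x powr \<gamma>"
      have c: "0 \<le> ?c \<or> \<phi> n x = 0" for n
        unfolding \<phi>_def using True x k[OF True] w0[of n x] assms(7,11)
        by (intro singular_term_nonneg[of _ _ _ _ \<epsilon>]) (auto simp: z_def)
      \<comment> \<open>Only the cut-off depends on n, and z is nonnegative.\<close>
      have mono: "\<phi> m x \<le> \<phi> n x" if "m \<le> n" for n
        unfolding \<phi>_def w_def using cutoff_mono[OF that, of \<Omega> x] z0(1)[of x]
        by (intro max.mono diff_mono mult_right_mono) auto
      have nn: "0 \<le> \<phi> n x" for n by (simp add: \<phi>_def)
      have "0 \<le> ?c * \<phi> n x" for n using c[of n] nn[of n] by auto
      moreover have "?c * \<phi> m x \<le> ?c * \<phi> n x" if "m \<le> n" for n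
        using c[of n] mono[OF that] nn[of m] by (auto intro: mult_left_mono)
      ultimately show ?thesis using True by (simp add: F_def)
    qed (simp add: F_def)
  qed

  have F_small: "(LINT x|lebesgue. F m x) \<le> \<eta> * (2 powr p * (LINT y|?M. G y))" if "0 < \<eta>" for m \<eta>
  proof -
    obtain C where C: "0 \<le> C"
      "\<And>e vx vy wx wy ux uy zx zy \<phi>x \<phi>y.
       \<lbrakk>zx = max 0 (vx - e); zy = max 0 (vy - e); 0 \<le> wx; wx \<le> zx; 0 \<le> wy; wy \<le> zy;
        0 \<le> ux; 0 \<le> uy; \<phi>x = max 0 (wx - ux); \<phi>y = max 0 (wy - uy)\<rbrakk> \<Longrightarrow>
       (signed_pow p (ux - uy) - signed_pow p (vx - vy)) * (\<phi>x - \<phi>y)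
         \<le> C * \<bar>signed_pow p (zx - zy) - signed_pow p (wx - wy)\<bar> powr (p / (p - 1))
            + \<eta> * \<bar>wx - wy\<bar> powr p"
      using that by (rule pointwise_monotonicity[OF assms(6) \<open>0 < \<eta>\<close>])
    \<comment> \<open>The index m stays fixed. Monotonicity passes to a later n, for which the
      equations are tested; C depends on \<eta> but not on n, so its term disappears as n
      grows.\<close>
    have est: "(LINT x|lebesgue. F m x) \<le> C * (LINT y|?M. D n y) + \<eta> * (2 powr p * (LINT y|?M. G y))"
      if "m \<le> n" for n
    proof -
      have "(LINT x|lebesgue. F m x) \<le> (LINT x|lebesgue. F n x)"
        by (rule integral_mono_AE[OF F_int F_int], rule eventually_mono[OF F_nonneg[of m]])
          (use that in blast)
      also have "\<dots> \<le> (LINT y|?M. C * D n y + \<eta> * (2 powr p * G y))"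
        unfolding F_eq
      proof (intro integral_mono_AE W_int)
        show "AE y in ?M. weak_integrand s p u (\<phi> n) y - weak_integrand s p v (\<phi> n) y
            \<le> C * D n y + \<eta> * (2 powr p * G y)"
          using AE_lebesgue_pair[OF posu']
        proof (rule eventually_mono)
          fix y :: "'a \<times> 'a"
          assume pos: "0 \<le> u (fst y) \<and> 0 \<le> u (snd y)"
          let ?k = "riesz_kernel (s * p) y"
          let ?X = "\<bar>signed_pow p (z (fst y) - z (snd y)) - signed_pow p (w n (fst y) - w n (snd y))\<bar>
              powr (p / (p - 1))"
          let ?A = "\<bar>w n (fst y) - w n (snd y)\<bar> powr p"
          have "(signed_pow p (u (fst y) - u (snd y)) - signed_pow p (v (fst y) - v (snd y)))
              * (\<phi> n (fst y) - \<phi> n (snd y)) \<le> C * ?X + \<eta> * ?A"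
            by (rule C(2)[OF z_def z_def]) (use pos w0 in \<open>auto simp: \<phi>_def\<close>)
          then have "(signed_pow p (u (fst y) - u (snd y)) - signed_pow p (v (fst y) - v (snd y)))
              * (\<phi> n (fst y) - \<phi> n (snd y)) * ?k \<le> (C * ?X + \<eta> * ?A) * ?k"
            by (rule mult_right_mono) simp
          also have "\<dots> = C * D n y + \<eta> * (?A * ?k)"
            by (simp add: D_def algebra_simps)
          also have "\<dots> \<le> C * D n y + \<eta> * (2 powr p * G y)"
            using \<open>0 < \<eta>\<close> by (intro add_left_mono mult_left_mono wG) simp
          finally show "weak_integrand s p u (\<phi> n) y - weak_integrand s p v (\<phi> n) y
            \<le> C * D n y + \<eta> * (2 powr p * G y)"
            by (simp add: weak_integrand_riesz_kernel left_diff_distrib)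
        qed
        show "integrable ?M (\<lambda>y. C * D n y + \<eta> * (2 powr p * G y))"
          using D_int G by simp
      qed
      also have "\<dots> = C * (LINT y|?M. D n y) + \<eta> * (2 powr p * (LINT y|?M. G y))"
        using D_int G by simp
      finally show ?thesis .
    qed
    have "(\<lambda>n. C * (LINT y|?M. D n y) + \<eta> * (2 powr p * (LINT y|?M. G y)))
        \<longlonglongrightarrow> C * 0 + \<eta> * (2 powr p * (LINT y|?M. G y))"
      by (intro tendsto_intros D_lim)
    then have "(LINT x|lebesgue. F m x) \<le> C * 0 + \<eta> * (2 powr p * (LINT y|?M. G y))"
      by (rule LIMSEQ_le_const) (use est in blast)
    then show ?thesis by simp
  qed
  have "AE x in lebesgue. F m x = 0" for m
  proof -
    \<comment> \<open>The integral of \<open>G\<close> depends on neither n nor \<eta>, so letting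
      \<eta> tend to 0 leaves a nonnegative function with nonpositive integral.\<close>
    have "((\<lambda>\<eta>. \<eta> * (2 powr p * (LINT y|?M. G y))) \<longlongrightarrow> 0 * (2 powr p * (LINT y|?M. G y))) (at_right 0)"
      by (intro tendsto_intros)
    then have "(LINT x|lebesgue. F m x) \<le> 0 * (2 powr p * (LINT y|?M. G y))"
      by (rule tendsto_lowerbound) (auto simp: eventually_at_right_less F_small intro: eventually_mono[OF eventually_at_right_less])
    moreover have nn: "AE x in lebesgue. 0 \<le> F m x"
      using F_nonneg[of m] by (auto elim: eventually_mono)
    then have "0 \<le> (LINT x|lebesgue. F m x)" by (rule integral_nonneg_AE)
    ultimately have "(LINT x|lebesgue. F m x) = 0" by simp
    then show ?thesis using integral_nonneg_eq_0_iff_AE[OF F_int nn] by simp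
  qed
  then have "AE x in lebesgue. \<forall>m. F m x = 0"
    unfolding AE_all_countable by blast
  with posu posv show ?thesis
  proof eventually_elim
    fix x assume x: "x \<in> \<Omega> \<longrightarrow> 0 < u x" "x \<in> \<Omega> \<longrightarrow> 0 < v x" and F: "\<forall>m. F m x = 0"
    show "x \<in> \<Omega> \<longrightarrow> v x \<le> u x + \<epsilon>"
    proof (rule impI, rule ccontr)
      assume "x \<in> \<Omega>" and "\<not> v x \<le> u x + \<epsilon>"
      \<comment> \<open>If v > u + \<epsilon> at x, then z > u there and the singular factor is
        strictly positive. So all test functions vanish at x, that is w_m \<le> u, and the limit
        gives z \<le> u, a contradiction.\<close>
      then have uv: "0 < u x" "u x < v x" "u x < z x" using x assms(11) by (auto simp: z_def)
      then have "u x powr \<gamma> < v x powr \<gamma>" using assms(7) by (intro powr_less_mono2) auto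
      then have lt: "k x / v x powr \<gamma> < k x / u x powr \<gamma>"
        using k[OF \<open>x \<in> \<Omega>\<close>] uv by (intro divide_strict_left_mono) auto
      have "\<phi> m x = 0" for m
      proof -
        have "(k x / u x powr \<gamma> - k x / v x powr \<gamma>) * \<phi> m x = 0"
          using spec[OF F, of m] \<open>x \<in> \<Omega>\<close> unfolding F_def by (simp only: indicator_simps mult_1)
        then show ?thesis using lt unfolding mult_eq_0_iff by linarith
      qed
      then have le: "w m x \<le> u x" for m
        using uv(1) by (metis \<phi>_def diff_gt_0_iff_gt max.absorb2 max_def not_le order_less_imp_le)
      have "(\<lambda>m. w m x) \<longlonglongrightarrow> 1 * z x"
        unfolding w_def using \<open>x \<in> \<Omega>\<close> infdist_Compl_pos_iff[OF assms(1,2)]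
        by (intro tendsto_intros cutoff_tendsto) auto
      then have "1 * z x \<le> u x"
        by (rule LIMSEQ_le_const2) (use le in blast)
      then show False using uv by simp
    qed
  qed
qed

text \<open>Taking \<epsilon> = 1/(n+1) keeps the union of the exceptional null sets
  countable.\<close>

lemma weak_comparison:
  fixes \<Omega> :: "'a::euclidean_space set"
  assumes "open \<Omega>" "bounded \<Omega>" "C11_boundary \<Omega>" "0 < s" "s < 1" "1 < p" "0 < \<gamma>"
    and "\<And>x. x \<in> \<Omega> \<Longrightarrow> 0 < k x"
    and "weak_solution s p \<Omega> \<gamma> k u" "weak_solution s p \<Omega> \<gamma> k v"
  shows "AE x in lebesgue. x \<in> \<Omega> \<longrightarrow> v x \<le> u x"
proof -
  have "AE x in lebesgue. \<forall>n. x \<in> \<Omega> \<longrightarrow> v x \<le> u x + inverse (real (Suc n))"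
    unfolding AE_all_countable
    by (intro allI weak_solution_le_add[OF assms]) auto
  then show ?thesis
  proof (rule eventually_mono, intro impI)
    fix x assume x: "\<forall>n. x \<in> \<Omega> \<longrightarrow> v x \<le> u x + inverse (real (Suc n))" "x \<in> \<Omega>"
    show "v x \<le> u x"
    proof (rule ccontr)
      assume "\<not> v x \<le> u x"
      then obtain n where "inverse (real (Suc n)) < v x - u x"
        using reals_Archimedean[of "v x - u x"] by auto
      moreover have "v x \<le> u x + inverse (real (Suc n))" using x by blast
      ultimately show False by linarith
    qed
  qed
qed

theorem corollary1p1:
  fixes \<Omega> :: "'a::euclidean_space set"
    and s p \<gamma> \<delta> C1 C2 :: real
    and K\<delta> u :: "'a \<Rightarrow> real"
  assumes "open \<Omega>" "connected \<Omega>" "\<Omega> \<noteq> {}" "bounded \<Omega>" "C11_boundary \<Omega>"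
    and "0 < s" "s < 1" and "1 < p" and "0 < \<gamma>"
    and "0 < \<delta>" "\<delta> < s * p" "\<delta> < 1 + s - 1 / p"
    and "0 < C1" "0 < C2"
    and "\<And>x. x \<in> \<Omega> \<Longrightarrow> C1 * infdist x (frontier \<Omega>) powr (- \<delta>) \<le> K\<delta> x"
    and "\<And>x. x \<in> \<Omega> \<Longrightarrow> K\<delta> x \<le> C2 * infdist x (frontier \<Omega>) powr (- \<delta>)"
    and "minimal_weak_solution s p \<Omega> \<gamma> K\<delta> u"
  shows "weak_solution s p \<Omega> \<gamma> K\<delta> u \<and>
    (\<forall>v. weak_solution s p \<Omega> \<gamma> K\<delta> v \<longrightarrow> (AE x in lebesgue. x \<in> \<Omega> \<longrightarrow> v x = u x))"
proof (intro conjI allI impI)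
  show u: "weak_solution s p \<Omega> \<gamma> K\<delta> u"
    using assms(17) by (simp add: minimal_weak_solution_def)
  fix v assume v: "weak_solution s p \<Omega> \<gamma> K\<delta> v"
  \<comment> \<open>The distance to an empty set would be 0 by convention, and
    \<open>0 powr _\<close> is 0, so the lower bound on the weight gives positivity only once the
    boundary is known to be nonempty.\<close>
  have "frontier \<Omega> \<noteq> {}"
    using assms(3,4) frontier_eq_empty not_bounded_UNIV by blast
  then have pos: "0 < K\<delta> x" if "x \<in> \<Omega>" for x
  proof -
    have "x \<notin> frontier \<Omega>" using that assms(1) by (simp add: frontier_def interior_open)
    then have "0 < infdist x (frontier \<Omega>)"
      using \<open>frontier \<Omega> \<noteq> {}\<close> infdist_pos_not_in_closed[OF frontier_closed] by blast
    then have "0 < C1 * infdist x (frontier \<Omega>) powr (- \<delta>)" using assms(13) by simp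
    then show ?thesis using assms(15)[OF that] by linarith
  qed
  have "AE x in lebesgue. x \<in> \<Omega> \<longrightarrow> v x \<le> u x"
    using weak_comparison[OF assms(1,4-9) pos u v] .
  moreover have "AE x in lebesgue. x \<in> \<Omega> \<longrightarrow> u x \<le> v x"
    using weak_comparison[OF assms(1,4-9) pos v u] .
  ultimately show "AE x in lebesgue. x \<in> \<Omega> \<longrightarrow> v x = u x"
    by eventually_elim auto
qed

end
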